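(* Let $k$ be an algebraically closed field of characteristic $p>0$, let $\mathfrak{g}_1,\mathfrak{g}_2$ be finite-dimensional restricted Lie algebras over $k$, and let $\mathfrak{t}_i\subseteq\mathfrak{g}_i$ be tori of maximal dimension for $i\in\{1,2\}$. Then $\mathfrak{t}_1\oplus\mathfrak{t}_2\subseteq\mathfrak{g}_1\oplus\mathfrak{g}_2$ is a torus of maximal dimension, and $$S(\mathfrak{g}_1\oplus\mathfrak{g}_2,\mathfrak{t}_1\oplus\mathfrak{t}_2)\simeq S(\mathfrak{g}_1,\mathfrak{t}_1)\times S(\mathfrak{g}_2,\mathfrak{t}_2).$$
   Context: A torus of a restricted Lie algebra $(\mathfrak{g},[p])$ is an abelian $p$-subalgebra consisting of semisimple elements ($x$ is semisimple if it lies in the $p$-subalgebra generated by $x^{[p]}$). "Maximal dimension" means dimension $\mu(\mathfrak{g})$, the maximum of the dimensions of all tori of $\mathfrak{g}$. For a torus $\mathfrak{t}\subseteq\mathfrak{g}$ of maximal dimension, let $\mathcal{T}_{\mathfrak{g}}(k)$ be the variety (a smooth affine variety, with Zariski topology from $\mathrm{Hom}_k(\mathfrak{t},\mathfrak{g})$) of injective homomorphisms $\mathfrak{t}\to\mathfrak{g}$ of restricted Lie algebras, and $\mathcal{X}_{\mathfrak{t}}(k)$ its irreducible (equivalently, connected) component containing the inclusion $\mathfrak{t}\hookrightarrow\mathfrak{g}$. The finite group $\mathrm{Aut}_p(\mathfrak{t})$ of automorphisms of the restricted Lie algebra $\mathfrak{t}$ acts on $\mathcal{T}_{\mathfrak{g}}(k)$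 by $h\cdot\varphi=\varphi\circ h^{-1}$, and $S(\mathfrak{g},\mathfrak{t})=\mathrm{Stab}_{\mathrm{Aut}_p(\mathfrak{t})}(\mathcal{X}_{\mathfrak{t}}(k))$. *)

theory Defs
  imports
    "HOL-Computational_Algebra.Polynomial"
    "HOL-Algebra.Group_Action"
    "HOL-Library.Product_Plus"
    "HOL-Analysis.Abstract_Topology_2"
begin

section \<open>Restricted Lie algebras\<close>

text \<open>
  The underlying abelian group of a Lie algebra is a type \<open>'g\<close>, the ground field a type \<open>'k\<close>;
  the characteristic \<open>p\<close> is \<open>CHAR('k)\<close>.
\<close>

record ('k, 'g) rlie =
  smult :: "'k \<Rightarrow> 'g \<Rightarrow> 'g"
  brk :: "'g \<Rightarrow> 'g \<Rightarrow> 'g"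
  pmap :: "'g \<Rightarrow> 'g"

text \<open>
  The bracket of the extended Lie algebra obtained by adjoining a variable \<open>X\<close>: a function
  \<open>f :: nat \<Rightarrow> 'g\<close> stands for the sum of the \<open>f n \<otimes> X^n\<close>.
\<close>

definition ext_brk :: "('k, 'g::ab_group_add) rlie \<Rightarrow> (nat \<Rightarrow> 'g) \<Rightarrow> (nat \<Rightarrow> 'g) \<Rightarrow> nat \<Rightarrow> 'g" where
  "ext_brk L f g n = (\<Sum>i\<le>n. brk L (f i) (g (n - i)))"

text \<open>
  Jacobson's Lie polynomials \<open>s_i(x,y)\<close>, \<open>0 < i < p\<close>, determined by
  \<open>ad(x \<otimes> X + y \<otimes> 1)^(p-1) (x \<otimes> 1) = (\<Sum>i=1..p-1. i s_i(x,y) \<otimes> X^(i-1))\<close>.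
\<close>

definition jacobson :: "('k::field, 'g::ab_group_add) rlie \<Rightarrow> nat \<Rightarrow> 'g \<Rightarrow> 'g \<Rightarrow> 'g" where
  "jacobson L i x y = smult L (inverse (of_nat i))
     (((ext_brk L (\<lambda>n. if n = 0 then y else if n = 1 then x else 0) ^^ (CHAR('k) - 1))
        (\<lambda>n. if n = 0 then x else 0)) (i - 1))"

locale restricted_lie_algebra = vector_space "smult L"
  for L :: "('k::field, 'g::ab_group_add) rlie" +
  assumes brk_add_left: "brk L (x + y) z = brk L x z + brk L y z"
    and brk_add_right: "brk L x (y + z) = brk L x y + brk L x z"
    and brk_smult_left: "brk L (smult L a x) y = smult L a (brk L x y)"
    and brk_smult_right: "brk L x (smult L a y) = smult L a (brk L x y)"
    and brk_self: "brk L x x = 0"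
    and jacobi: "brk L x (brk L y z) + brk L y (brk L z x) + brk L z (brk L x y) = 0"
    and ad_pmap: "brk L (pmap L x) y = (brk L x ^^ CHAR('k)) y"
    and pmap_smult: "pmap L (smult L a x) = smult L (a ^ CHAR('k)) (pmap L x)"
    and pmap_add: "pmap L (x + y) = pmap L x + pmap L y + (\<Sum>i = 1..<CHAR('k). jacobson L i x y)"

definition finite_dimensional :: "('k::field, 'g::ab_group_add) rlie \<Rightarrow> bool" where
  "finite_dimensional L \<longleftrightarrow> (\<exists>B. finite B \<and> module.span (smult L) B = UNIV)"

definition direct_sum :: "('k, 'a) rlie \<Rightarrow> ('k, 'b) rlie \<Rightarrow> ('k, 'a \<times> 'b) rlie"
    (infixr \<open>\<oplus>\<^sub>L\<close> 65) where
  "L1 \<oplus>\<^sub>L L2 =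
     \<lparr>smult = (\<lambda>c (x, y). (smult L1 c x, smult L2 c y)),
      brk = (\<lambda>(x, y) (x', y'). (brk L1 x x', brk L2 y y')),
      pmap = (\<lambda>(x, y). (pmap L1 x, pmap L2 y))\<rparr>"

lemma restricted_lie_algebra_direct_sum:
  assumes "restricted_lie_algebra L1" "restricted_lie_algebra L2"
  shows "restricted_lie_algebra (L1 \<oplus>\<^sub>L L2)"
proof -
  interpret L1: restricted_lie_algebra L1 by fact
  interpret L2: restricted_lie_algebra L2 by fact
  let ?L = "L1 \<oplus>\<^sub>L L2"
  have brk: "brk ?L u v = (brk L1 (fst u) (fst v), brk L2 (snd u) (snd v))" for u v
    by (simp add: direct_sum_def case_prod_beta)
  have pm: "pmap ?L u = (pmap L1 (fst u), pmap L2 (snd u))" for u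
    by (simp add: direct_sum_def case_prod_beta)
  have ad: "(brk ?L u ^^ m) v = ((brk L1 (fst u) ^^ m) (fst v), (brk L2 (snd u) ^^ m) (snd v))"
    for u v m by (induction m) (auto simp: brk)
  have fst_sum: "fst (sum f A) = (\<Sum>i\<in>A. fst (f i))" and snd_sum: "snd (sum f A) = (\<Sum>i\<in>A. snd (f i))"
    for f :: "nat \<Rightarrow> 'b \<times> 'c" and A by (induction A rule: infinite_finite_induct) auto
  have ext: "ext_brk ?L f g n =
      (ext_brk L1 (\<lambda>n. fst (f n)) (\<lambda>n. fst (g n)) n, ext_brk L2 (\<lambda>n. snd (f n)) (\<lambda>n. snd (g n)) n)"
    for f g n by (rule prod_eqI) (simp_all add: ext_brk_def brk fst_sum snd_sum)
  have ext_iter: "(ext_brk ?L f ^^ m) g n =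
      ((ext_brk L1 (\<lambda>n. fst (f n)) ^^ m) (\<lambda>n. fst (g n)) n,
       (ext_brk L2 (\<lambda>n. snd (f n)) ^^ m) (\<lambda>n. snd (g n)) n)"
    for f g n m by (induction m arbitrary: n) (auto simp: ext)
  have jac: "jacobson ?L i u v =
      (jacobson L1 i (fst u) (fst v), jacobson L2 i (snd u) (snd v))" for i u v
    unfolding jacobson_def ext_iter by (simp add: direct_sum_def if_distrib[where f = fst] if_distrib[where f = snd]
      cong: if_cong)
  show ?thesis
  proof
    show "pmap ?L (u + v) = pmap ?L u + pmap ?L v + (\<Sum>i = 1..<CHAR('a). jacobson ?L i u v)" for u v
      by (rule prod_eqI)
        (simp_all add: jac fst_sum snd_sum pm L1.pmap_add L2.pmap_add)
    show "brk ?L (pmap ?L u) v = (brk ?L u ^^ CHAR('a)) v" for u v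
      unfolding ad by (simp add: brk pm L1.ad_pmap L2.ad_pmap)
  qed (auto simp: direct_sum_def case_prod_beta L1.scale_right_distrib L2.scale_right_distrib
      L1.scale_left_distrib L2.scale_left_distrib
      L1.brk_add_left L2.brk_add_left L1.brk_add_right L2.brk_add_right
      L1.brk_smult_left L2.brk_smult_left L1.brk_smult_right L2.brk_smult_right
      L1.brk_self L2.brk_self L1.jacobi L2.jacobi L1.pmap_smult L2.pmap_smult zero_prod_def)
qed


section \<open>Tori\<close>

definition p_subalgebra :: "('k::field, 'g::ab_group_add) rlie \<Rightarrow> 'g set \<Rightarrow> bool" where
  "p_subalgebra L h \<longleftrightarrow> module.subspace (smult L) h \<and>
     (\<forall>x\<in>h. \<forall>y\<in>h. brk L x y \<in> h) \<and> (\<forall>x\<in>h. pmap L x \<in> h)"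

definition semisimple :: "('k::field, 'g::ab_group_add) rlie \<Rightarrow> 'g \<Rightarrow> bool" where
  "semisimple L x \<longleftrightarrow> x \<in> p_subalgebra L hull {pmap L x}"

definition torus :: "('k::field, 'g::ab_group_add) rlie \<Rightarrow> 'g set \<Rightarrow> bool" where
  "torus L t \<longleftrightarrow> p_subalgebra L t \<and> (\<forall>x\<in>t. \<forall>y\<in>t. brk L x y = 0) \<and> (\<forall>x\<in>t. semisimple L x)"

definition torus_rank :: "('k::field, 'g::ab_group_add) rlie \<Rightarrow> nat" where
  "torus_rank L = Max {vector_space.dim (smult L) t | t. torus L t}"

definition maximal_dim_torus :: "('k::field, 'g::ab_group_add) rlie \<Rightarrow> 'g set \<Rightarrow> bool" where
  "maximal_dim_torus L t \<longleftrightarrow> torus L t \<and> vector_space.dim (smult L) t = torus_rank L"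


section \<open>The variety of embeddings of a torus\<close>

text \<open>
  Maps defined on the subspace \<open>t\<close> are represented by functions on \<open>'g\<close> that are extensional
  on \<open>t\<close>.
\<close>

definition lin_maps :: "('k, 'g::ab_group_add) rlie \<Rightarrow> 'g set \<Rightarrow> ('g \<Rightarrow> 'g) set" where
  "lin_maps L t = {\<phi> \<in> extensional t.
     (\<forall>x\<in>t. \<forall>y\<in>t. \<phi> (x + y) = \<phi> x + \<phi> y) \<and> (\<forall>c. \<forall>x\<in>t. \<phi> (smult L c x) = smult L c (\<phi> x))}"

definition restricted_homs :: "('k, 'g::ab_group_add) rlie \<Rightarrow> 'g set \<Rightarrow> ('g \<Rightarrow> 'g) set" where
  "restricted_homs L t = {\<phi> \<in> lin_maps L t.
     (\<forall>x\<in>t. \<forall>y\<in>t. \<phi> (brk L x y) = brk L (\<phi> x) (\<phi> y)) \<and> (\<forall>x\<in>t. \<phi> (pmap L x) = pmap L (\<phi> x))}"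

definition torus_embeddings :: "('k, 'g::ab_group_add) rlie \<Rightarrow> 'g set \<Rightarrow> ('g \<Rightarrow> 'g) set" where
  "torus_embeddings L t = {\<phi> \<in> restricted_homs L t. inj_on \<phi> t}"

text \<open>
  The polynomial functions on \<open>Hom(t,g)\<close>: the algebra generated by the matrix coefficients
  \<open>\<phi> \<mapsto> l (\<phi> x)\<close>, which span the dual space of \<open>Hom(t,g)\<close> when \<open>t\<close> and \<open>g\<close> are
  finite-dimensional.
\<close>

inductive_set poly_funs :: "('k::field, 'g::ab_group_add) rlie \<Rightarrow> 'g set \<Rightarrow> (('g \<Rightarrow> 'g) \<Rightarrow> 'k) set"
  for L t where
  coeff: "Vector_Spaces.linear (smult L) (*) l \<Longrightarrow> x \<in> t \<Longrightarrow> (\<lambda>\<phi>. l (\<phi> x)) \<in> poly_funs L t"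
| const: "(\<lambda>\<phi>. c) \<in> poly_funs L t"
| add: "f \<in> poly_funs L t \<Longrightarrow> g \<in> poly_funs L t \<Longrightarrow> (\<lambda>\<phi>. f \<phi> + g \<phi>) \<in> poly_funs L t"
| mult: "f \<in> poly_funs L t \<Longrightarrow> g \<in> poly_funs L t \<Longrightarrow> (\<lambda>\<phi>. f \<phi> * g \<phi>) \<in> poly_funs L t"

definition zariski_closed :: "('k::field, 'g::ab_group_add) rlie \<Rightarrow> 'g set \<Rightarrow> ('g \<Rightarrow> 'g) set \<Rightarrow> bool" where
  "zariski_closed L t C \<longleftrightarrow> (\<exists>F\<subseteq>poly_funs L t. C = {\<phi> \<in> lin_maps L t. \<forall>f\<in>F. f \<phi> = 0})"

definition zariski :: "('k::field, 'g::ab_group_add) rlie \<Rightarrow> 'g set \<Rightarrow> ('g \<Rightarrow> 'g) topology" where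
  "zariski L t = topology (\<lambda>U. U \<subseteq> lin_maps L t \<and> zariski_closed L t (lin_maps L t - U))"

lemma istopology_zariski:
  "istopology (\<lambda>U. U \<subseteq> lin_maps L t \<and> zariski_closed L t (lin_maps L t - U))"
  unfolding istopology_def
proof (intro conjI allI impI)
  fix U V
  assume U: "U \<subseteq> lin_maps L t \<and> zariski_closed L t (lin_maps L t - U)"
    and V: "V \<subseteq> lin_maps L t \<and> zariski_closed L t (lin_maps L t - V)"
  from U V show "U \<inter> V \<subseteq> lin_maps L t" by blast
  from U V obtain F G where F: "F \<subseteq> poly_funs L t" "G \<subseteq> poly_funs L t"
    "lin_maps L t - U = {\<phi> \<in> lin_maps L t. \<forall>f\<in>F. f \<phi> = 0}"
    "lin_maps L t - V = {\<phi> \<in> lin_maps L t. \<forall>f\<in>G. f \<phi> = 0}"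
    unfolding zariski_closed_def by blast
  let ?H = "(\<lambda>(f, g) \<phi>. f \<phi> * g \<phi>) ` (F \<times> G)"
  have "?H \<subseteq> poly_funs L t" using F(1,2) by (auto intro: poly_funs.mult)
  moreover have "lin_maps L t - U \<inter> V = {\<phi> \<in> lin_maps L t. \<forall>h\<in>?H. h \<phi> = 0}"
  proof -
    have *: "(\<forall>h\<in>?H. h \<phi> = 0) \<longleftrightarrow> (\<forall>f\<in>F. f \<phi> = 0) \<or> (\<forall>g\<in>G. g \<phi> = 0)" for \<phi>
    proof -
      have "(\<forall>h\<in>?H. h \<phi> = 0) \<longleftrightarrow> (\<forall>f\<in>F. \<forall>g\<in>G. f \<phi> * g \<phi> = 0)" by auto
      then show ?thesis unfolding mult_eq_0_iff by meson
    qed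
    have "{\<phi> \<in> lin_maps L t. \<forall>h\<in>?H. h \<phi> = 0} = (lin_maps L t - U) \<union> (lin_maps L t - V)"
      unfolding F(3,4) * by blast
    then show ?thesis by (simp only: Diff_Int)
  qed
  ultimately show "zariski_closed L t (lin_maps L t - U \<inter> V)"
    unfolding zariski_closed_def by blast
next
  fix K
  assume K: "\<forall>U\<in>K. U \<subseteq> lin_maps L t \<and> zariski_closed L t (lin_maps L t - U)"
  then show "\<Union>K \<subseteq> lin_maps L t" by blast
  from K have "\<forall>U\<in>K. \<exists>F. F \<subseteq> poly_funs L t \<and>
      lin_maps L t - U = {\<phi> \<in> lin_maps L t. \<forall>f\<in>F. f \<phi> = 0}"
    unfolding zariski_closed_def by simp
  from bchoice[OF this] obtain F where F: "\<forall>U\<in>K. F U \<subseteq> poly_funs L t \<and>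
      lin_maps L t - U = {\<phi> \<in> lin_maps L t. \<forall>f\<in>F U. f \<phi> = 0}"
    by (rule exE)
  have "lin_maps L t - \<Union>K = {\<phi> \<in> lin_maps L t. \<forall>f\<in>\<Union>(F ` K). f \<phi> = 0}"
  proof -
    have "\<phi> \<in> U \<longleftrightarrow> \<not> (\<forall>f\<in>F U. f \<phi> = 0)" if "U \<in> K" "\<phi> \<in> lin_maps L t" for U \<phi>
    proof -
      have "lin_maps L t - U = {\<phi> \<in> lin_maps L t. \<forall>f\<in>F U. f \<phi> = 0}" using bspec[OF F that(1)] by (rule conjunct2)
      then have "\<phi> \<in> lin_maps L t - U \<longleftrightarrow> \<phi> \<in> {\<phi> \<in> lin_maps L t. \<forall>f\<in>F U. f \<phi> = 0}" by (rule arg_cong)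
      then show ?thesis using that(2) by blast
    qed
    then show ?thesis by blast
  qed
  moreover have "\<Union>(F ` K) \<subseteq> poly_funs L t" using F by blast
  ultimately show "zariski_closed L t (lin_maps L t - \<Union>K)"
    unfolding zariski_closed_def by blast
qed

lemma openin_zariski:
  "openin (zariski L t) U \<longleftrightarrow> U \<subseteq> lin_maps L t \<and> zariski_closed L t (lin_maps L t - U)"
  unfolding zariski_def topology_inverse'[OF istopology_zariski] by (rule refl)

text \<open>
  The component of the inclusion of \<open>t\<close> in the variety of embeddings. Since that variety is smooth
  if \<open>t\<close> is a torus of maximal dimension, its connected components are its irreducible components.
\<close>

definition embedding_component :: "('k::field, 'g::ab_group_add) rlie \<Rightarrow> 'g set \<Rightarrow> ('g \<Rightarrow> 'g) set" where
  "embedding_component L t =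
     connected_component_of_set (subtopology (zariski L t) (torus_embeddings L t)) (\<lambda>x\<in>t. x)"


section \<open>Automorphisms and the stabilizer\<close>

definition Aut_p :: "('k, 'g::ab_group_add) rlie \<Rightarrow> 'g set \<Rightarrow> ('g \<Rightarrow> 'g) monoid" where
  "Aut_p L t = BijGroup t \<lparr>carrier := restricted_homs L t \<inter> Bij t\<rparr>"

definition aut_action :: "('k, 'g::ab_group_add) rlie \<Rightarrow> 'g set \<Rightarrow> ('g \<Rightarrow> 'g) \<Rightarrow> ('g \<Rightarrow> 'g) \<Rightarrow> 'g \<Rightarrow> 'g" where
  "aut_action L t h \<phi> = compose t \<phi> (inv\<^bsub>Aut_p L t\<^esub> h)"

definition S_group :: "('k::field, 'g::ab_group_add) rlie \<Rightarrow> 'g set \<Rightarrow> ('g \<Rightarrow> 'g) monoid" where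
  "S_group L t = (Aut_p L t)
     \<lparr>carrier := stabilizer (Aut_p L t) (\<lambda>h. image (aut_action L t h)) (embedding_component L t)\<rparr>"

end

theory Submission
  imports Defs "HOL-Analysis.Product_Vector" "HOL-Analysis.Abstract_Topological_Spaces"
begin

text \<open>
  The tori of the sum. A torus of \<open>L1 \<oplus>\<^sub>L L2\<close> projects onto tori of the summands and is
  contained in the product of its projections, so its dimension is at most \<open>dim t1 + dim t2\<close>. It
  remains to see that \<open>t1 \<times> t2\<close> is a torus. That \<open>x\<close> and \<open>y\<close> are semisimple expresses each of them
  by its own \<open>p\<close>-polynomial, and these need not agree; but over an algebraically closed field a
  finite-dimensional abelian \<open>p\<close>-subalgebra is a torus as soon as its \<open>p\<close>-map is injective
  (\<open>torus_pmap_eq_0\<close>, \<open>torus_if_pmap_injective\<close>), and injectivity can be checked in each summand.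

  The stabilizer. Precomposition with the inverse of an automorphism \<open>h\<close> is a homeomorphism of the
  space of embeddings, and it moves the inclusion to the inverse of \<open>h\<close>. Hence \<open>h\<close> stabilizes the
  component of the inclusion if and only if it belongs to it (\<open>carrier_S_group\<close>), and the theorem
  follows once the component \<open>X\<close> of the inclusion of \<open>t1 \<times> t2\<close> is identified with the product of the
  components for \<open>t1\<close> and \<open>t2\<close>.

  The main point is that the members of \<open>X\<close> are block diagonal. For each embedding \<open>\<phi>\<close> of
  \<open>t = t1 \<times> t2\<close>, the image of \<open>\<phi>\<close> is again a torus of maximal dimension, hence a product of two
  tori of maximal dimension, and so the kernel of \<open>fst \<circ> \<phi>\<close> has dimension \<open>dim t2\<close> (\<open>dim_kernels\<close>).
  This kernel is stable under the \<open>p\<close>-map. By Lang's theorem for the \<open>p\<close>-map of a torus, a stable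
  subspace is spanned by the vectors in it that the \<open>p\<close>-map fixes (\<open>stable_subspace_eq_span\<close>), and
  there are only finitely many of these in \<open>t\<close>. So the kernel takes finitely many values. As all of
  them have the same dimension, each value is taken on a closed set, and these sets are disjoint; the
  kernel is therefore constant on components (\<open>kernel_constant_on_component\<close>). On \<open>X\<close> it is
  \<open>{0} \<times> t2\<close>, its value at the inclusion. In the same way the kernel of \<open>snd \<circ> \<phi>\<close> is
  \<open>t1 \<times> {0}\<close> on \<open>X\<close>.

  The diagonal blocks depend continuously on \<open>\<phi>\<close>, so those of a member of \<open>X\<close> lie in the components
  for \<open>t1\<close> and \<open>t2\<close>. Conversely, a pair from these components is joined to the inclusion by moving
  one block at a time. The Zariski topology of a product is not the product topology, but the slices
  \<open>a \<mapsto> (a, b)\<close> and \<open>b \<mapsto> (a, b)\<close> are continuous, which is all that this needs.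
\<close>

section \<open>Equations over an algebraically closed field\<close>

lemma artin_schreier_root:
  fixes c :: "'k::alg_closed_field"
  assumes "p > 1"
  shows "\<exists>b. b ^ p - b = c"
proof -
  have "degree (monom 1 p + [:- c, - 1:]) = degree (monom (1::'k) p)"
    using assms by (intro degree_add_eq_left) (simp add: degree_monom_eq)
  then have "degree (monom 1 p + [:- c, - 1:]) > 0"
    using assms by (simp add: degree_monom_eq)
  then obtain b where "poly (monom 1 p + [:- c, - 1:]) b = 0"
    using alg_closed_imp_poly_has_root by blast
  then have "b ^ p - b = c" by (simp add: poly_monom algebra_simps)
  then show ?thesis by blast
qed

text \<open>
  If \<open>F\<close> is Frobenius-semilinear and \<open>(F ^^ Suc k) v = (\<Sum>i\<le>k. a i (F ^^ i) v)\<close>, then these equations say that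
  \<open>\<Sum>i\<le>k. c i (F ^^ i) v\<close> is fixed by \<open>F\<close>. Eliminating \<open>c 0, \<dots>, c (k - 1)\<close> leaves the equation \<open>D k = X\<close>
  for \<open>c k\<close>, where the polynomial \<open>D k\<close> is divisible by \<open>X\<^sup>2\<close>, and nonzero because \<open>a 0 \<noteq> 0\<close>. So
  \<open>D k / X - 1\<close> is a nonconstant polynomial that does not vanish at \<open>0\<close>, and any of its roots will do.
\<close>

lemma frobenius_recurrence_solvable:
  fixes a :: "nat \<Rightarrow> 'k::alg_closed_field"
  assumes p: "p > 1" and a0: "a 0 \<noteq> 0"
  shows "\<exists>c. c k \<noteq> 0 \<and> c 0 = a 0 * c k ^ p \<and> (\<forall>i<k. c (Suc i) = c i ^ p + a (Suc i) * c k ^ p)"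
proof -
  define D :: "nat \<Rightarrow> 'k poly" where
    "D = rec_nat (monom (a 0) p) (\<lambda>i d. d ^ p + monom (a (Suc i)) p)"
  have D0: "D 0 = monom (a 0) p" and DS: "\<And>i. D (Suc i) = D i ^ p + monom (a (Suc i)) p"
    by (simp_all add: D_def)
  have deg: "degree (D i) = p ^ Suc i" for i
  proof (induction i)
    case 0
    then show ?case using a0 by (simp add: D0 degree_monom_eq)
  next
    case (Suc i)
    have "p < p ^ Suc (Suc i)"
      using p power_strict_increasing[of 1 "Suc (Suc i)" p] by simp
    moreover have pw: "degree (D i ^ p) = p ^ Suc (Suc i)"
      using Suc p by (subst degree_power_eq) auto
    moreover have "degree (monom (a (Suc i)) p) \<le> p" by (rule degree_monom_le)
    ultimately have "degree (monom (a (Suc i)) p) < degree (D i ^ p)" by linarith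
    then show ?case unfolding DS using pw by (simp add: degree_add_eq_left)
  qed
  have mon: "[:0, 1:] ^ 2 dvd monom x p" for x :: 'k
    using p by (auto simp: monom_altdef le_imp_power_dvd intro!: dvd_smult)
  have dvd: "[:0, 1:] ^ 2 dvd D i" for i
  proof (induction i)
    case 0
    then show ?case by (simp add: D0 mon)
  next
    case (Suc i)
    have "D i dvd D i ^ p" using p by (simp add: dvd_power)
    then show ?case unfolding DS using Suc mon by (meson dvd_add dvd_trans)
  qed
  obtain q where q: "D k = [:0, 1:] ^ 2 * q" using dvd[of k] by (auto elim: dvdE)
  have "D k \<noteq> 0" using deg[of k] p by auto
  then have "q \<noteq> 0" using q by auto
  then have "degree (pCons (-1) q) > 0" by simp
  then obtain z where z: "poly (pCons (-1) q) z = 0"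
    using alg_closed_imp_poly_has_root by blast
  then have zq: "z * poly q z = 1" by simp
  then have z0: "z \<noteq> 0" by auto
  have "poly (D k) z = z * (z * poly q z)" by (simp add: q power2_eq_square)
  then have zk: "poly (D k) z = z" by (simp add: zq)
  show ?thesis
    by (rule exI[of _ "\<lambda>i. poly (D i) z"]) (auto simp: zk z0 D0 DS poly_monom)
qed

section \<open>Injective Frobenius-semilinear maps\<close>

locale frobenius_semilinear = finite_dimensional_vector_space scale Basis
  for scale :: "'k::alg_closed_field \<Rightarrow> 'v::ab_group_add \<Rightarrow> 'v" (infixr \<open>\<star>\<close> 75) and Basis :: "'v set" +
  fixes V :: "'v set" and F :: "'v \<Rightarrow> 'v"
  assumes char_pos: "CHAR('k) > 0"
    and subspace_V: "subspace V"
    and F_in: "x \<in> V \<Longrightarrow> F x \<in> V"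
    and F_add: "x \<in> V \<Longrightarrow> y \<in> V \<Longrightarrow> F (x + y) = F x + F y"
    and F_scale: "x \<in> V \<Longrightarrow> F (c \<star> x) = c ^ CHAR('k) \<star> F x"
    and F_eq_0: "x \<in> V \<Longrightarrow> F x = 0 \<Longrightarrow> x = 0"
begin

lemma char_gt_1: "CHAR('k) > 1"
  using prime_CHAR_semidom[OF char_pos] prime_gt_1_nat by blast

lemma F_0: "F 0 = 0"
  using F_scale[OF subspace_0[OF subspace_V], of 0] char_pos by (simp add: zero_power)

lemma F_diff: "x \<in> V \<Longrightarrow> y \<in> V \<Longrightarrow> F (x - y) = F x - F y"
  using F_add[of "x - y" y] subspace_diff[OF subspace_V] by simp

lemma F_inj_on: "inj_on F V"
  by (rule inj_onI) (metis F_diff F_eq_0 eq_iff_diff_eq_0 subspace_V subspace_diff)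

lemma F_sum:
  assumes "\<And>i. i \<in> I \<Longrightarrow> x i \<in> V"
  shows "F (\<Sum>i\<in>I. c i \<star> x i) = (\<Sum>i\<in>I. c i ^ CHAR('k) \<star> F (x i))"
  using assms
proof (induction I rule: infinite_finite_induct)
  case (insert i I)
  then show ?case
    by (simp add: F_add F_scale subspace_V subspace_scale subspace_sum)
qed (simp_all add: F_0)

definition frobenius_root :: "'k \<Rightarrow> 'k" where
  "frobenius_root c = (SOME b. b ^ CHAR('k) = c)"

lemma frobenius_root_power: "frobenius_root c ^ CHAR('k) = c"
  unfolding frobenius_root_def by (rule someI_ex) (rule nth_root_exists[OF char_pos])

text \<open>
  Since scalars have \<open>p\<close>-th roots, \<open>F ` W\<close> is a subspace, and \<open>F\<close> maps a basis of \<open>W\<close> to an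
  independent set; so \<open>F ` W\<close> and \<open>W\<close> have the same dimension.
\<close>

lemma image_eq_of_stable:
  assumes W: "subspace W" "W \<subseteq> V" and st: "F ` W \<subseteq> W"
  shows "F ` W = W"
proof -
  obtain B where B: "B \<subseteq> W" "independent B" "W \<subseteq> span B" "card B = dim W"
    using basis_exists by blast
  have finB: "finite B" using B(2) by (rule finiteI_independent)
  have BV: "B \<subseteq> V" using B(1) W(2) by blast
  have sub: "subspace (F ` W)"
    unfolding subspace_def
  proof (intro conjI ballI allI)
    show "0 \<in> F ` W" using F_0 subspace_0[OF W(1)] by (metis image_eqI)
  next
    fix x y assume "x \<in> F ` W" "y \<in> F ` W"
    then obtain x' y' where "x' \<in> W" "y' \<in> W" "x = F x'" "y = F y'" by blast
    then show "x + y \<in> F ` W"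
      using F_add W by (intro image_eqI[of _ _ "x' + y'"]) (simp_all add: subspace_add subset_iff)
  next
    fix c x assume "x \<in> F ` W"
    then obtain x' where "x' \<in> W" "x = F x'" by blast
    then show "c \<star> x \<in> F ` W"
      using F_scale W by (intro image_eqI[of _ _ "frobenius_root c \<star> x'"]) (simp_all add: frobenius_root_power subspace_scale subset_iff)
  qed
  have inj: "inj_on F B" using F_inj_on BV by (rule inj_on_subset)
  have "independent (F ` B)"
  proof (rule independent_if_scalars_zero)
    show "finite (F ` B)" using finB by simp
  next
    fix u x assume 0: "(\<Sum>x\<in>F ` B. u x \<star> x) = 0" and x: "x \<in> F ` B"
    have "F (\<Sum>b\<in>B. frobenius_root (u (F b)) \<star> b) = (\<Sum>b\<in>B. u (F b) \<star> F b)"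
      using BV by (subst F_sum) (auto simp: frobenius_root_power)
    also have "\<dots> = 0" using 0 by (simp add: sum.reindex[OF inj])
    finally have "(\<Sum>b\<in>B. frobenius_root (u (F b)) \<star> b) = 0"
      by (rule F_eq_0[rotated]) (use BV subspace_V in \<open>auto intro!: subspace_sum subspace_scale\<close>)
    then have "frobenius_root (u (F b)) = 0" if "b \<in> B" for b
      using B(2) finB that independentD by (metis order_refl)
    then show "u x = 0" using x frobenius_root_power char_pos by (metis imageE zero_power)
  qed
  then have "card (F ` B) \<le> dim (F ` W)"
    using B(1) by (intro independent_card_le_dim) auto
  then have "dim W \<le> dim (F ` W)" by (simp add: card_image[OF inj] B(4))
  then show ?thesis using subspace_dim_equal[OF sub W(1) st] by simp
qed

definition fixed_points :: "'v set" where
  "fixed_points = {x \<in> V. F x = x}"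

text \<open>
  In a basis that consists of fixed points, the coordinates of a fixed point satisfy \<open>c\<^sup>p = c\<close>.
\<close>

lemma finite_fixed_points: "finite fixed_points"
proof -
  obtain B where B: "B \<subseteq> fixed_points" "independent B" "fixed_points \<subseteq> span B"
    using basis_exists by metis
  have finB: "finite B" using B(2) by (rule finiteI_independent)
  let ?Z = "{c::'k. c ^ CHAR('k) = c}"
  have "finite {c. poly (monom 1 (CHAR('k)) - [:0, 1::'k:]) c = 0}"
  proof (rule poly_roots_finite)
    have "coeff (monom 1 (CHAR('k)) - [:0, 1::'k:]) 1 = - 1"
      using char_gt_1 by simp
    then show "monom 1 (CHAR('k)) - [:0, 1::'k:] \<noteq> 0" by force
  qed
  then have finZ: "finite ?Z" by (simp add: poly_monom)
  have "fixed_points \<subseteq> (\<lambda>u. \<Sum>b\<in>B. u b \<star> b) ` (B \<rightarrow>\<^sub>E ?Z)"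
  proof
    fix x assume x: "x \<in> fixed_points"
    then have "x \<in> span B" using B(3) by blast
    then obtain u where u: "x = (\<Sum>b\<in>B. u b \<star> b)" unfolding span_finite[OF finB] by blast
    have "F x = (\<Sum>b\<in>B. u b ^ CHAR('k) \<star> b)"
      unfolding u using B(1) by (subst F_sum) (auto simp: fixed_points_def intro!: sum.cong)
    then have "(\<Sum>b\<in>B. (u b ^ CHAR('k) - u b) \<star> b) = 0"
      using x u by (simp add: fixed_points_def scale_left_diff_distrib sum_subtractf)
    then have "u b ^ CHAR('k) - u b = 0" if "b \<in> B" for b
      using independentD[OF B(2) finB order_refl, of "\<lambda>b. u b ^ CHAR('k) - u b"] that by blast
    then have "restrict u B \<in> B \<rightarrow>\<^sub>E ?Z" by auto
    moreover have "x = (\<Sum>b\<in>B. restrict u B b \<star> b)" using u by simp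
    ultimately show "x \<in> (\<lambda>u. \<Sum>b\<in>B. u b \<star> b) ` (B \<rightarrow>\<^sub>E ?Z)" by blast
  qed
  moreover have "finite (B \<rightarrow>\<^sub>E ?Z)" using finB finZ by (intro finite_PiE) auto
  ultimately show ?thesis by (meson finite_imageI finite_subset)
qed

lemma span_fixed_points_subset: "span fixed_points \<subseteq> V"
  using subspace_V by (intro span_minimal) (auto simp: fixed_points_def)

lemma F_span_fixed_points: "F ` span fixed_points \<subseteq> span fixed_points"
proof clarify
  fix x assume "x \<in> span fixed_points"
  then have "x \<in> V \<and> F x \<in> span fixed_points"
  proof (induction rule: span_induct_alt)
    case base
    then show ?case by (simp add: F_0 span_zero subspace_0[OF subspace_V])
  next
    case (step c x y)
    then show ?case using subspace_V
      by (auto simp: F_add F_scale fixed_points_def subspace_scale subspace_add span_add span_scale span_base)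
  qed
  then show "F x \<in> span fixed_points" by blast
qed

text \<open>
  On the line through a fixed point \<open>x\<close>, the equation for \<open>u = b x\<close> and \<open>z = c x\<close> is the
  Artin-Schreier equation \<open>b\<^sup>p - b = c\<close>.
\<close>

lemma artin_schreier_on_span_fixed_points:
  assumes "z \<in> span fixed_points"
  shows "\<exists>u\<in>span fixed_points. F u - u = z"
  using assms
proof (induction rule: span_induct_alt)
  case base
  then show ?case by (intro bexI[of _ 0]) (simp_all add: F_0 span_zero)
next
  case (step c x y)
  then obtain u where u: "u \<in> span fixed_points" "F u - u = y" by blast
  obtain b where b: "b ^ CHAR('k) - b = c" using artin_schreier_root[OF char_gt_1] by blast
  have x: "x \<in> V" "F x = x" using step(1) by (auto simp: fixed_points_def)
  have "F (b \<star> x + u) = b ^ CHAR('k) \<star> x + F u"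
    using x u(1) span_fixed_points_subset subspace_V by (auto simp: F_add F_scale subspace_scale)
  then have "F (b \<star> x + u) - (b \<star> x + u) = (b ^ CHAR('k) - b) \<star> x + (F u - u)"
    by (simp add: scale_left_diff_distrib)
  then have "F (b \<star> x + u) - (b \<star> x + u) = c \<star> x + y" by (simp add: b u(2))
  moreover have "b \<star> x + u \<in> span fixed_points"
    using step(1) u(1) by (simp add: span_add span_base span_scale)
  ultimately show ?case by blast
qed

lemma sequence_dependent:
  fixes f :: "nat \<Rightarrow> 'v"
  shows "\<exists>n. f n \<in> span (f ` {..<n})"
proof (rule ccontr)
  assume "\<not> ?thesis"
  then have notin: "f n \<notin> span (f ` {..<n})" for n by blast
  have ind: "independent (f ` {..<n}) \<and> card (f ` {..<n}) = n" for n
  proof (induction n)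
    case 0
    show ?case by (simp add: independent_empty)
  next
    case (Suc n)
    have "f n \<notin> f ` {..<n}" by (rule contra_subsetD[OF span_superset notin])
    then have "card (insert (f n) (f ` {..<n})) = Suc n" by (simp add: conjunct2[OF Suc])
    moreover have "independent (insert (f n) (f ` {..<n}))"
      by (rule independent_insertI[OF notin conjunct1[OF Suc]])
    ultimately show ?case unfolding lessThan_Suc image_insert by (rule conjI[rotated])
  qed
  have "card (f ` {..<Suc dimension}) \<le> dim (UNIV :: 'v set)"
    by (rule independent_card_le_dim[OF subset_UNIV conjunct1[OF ind]])
  then have "Suc dimension \<le> dimension"
    by (simp only: conjunct2[OF ind] dim_UNIV dimension_def)
  then show False by simp
qed

text \<open>
  This is Lang's theorem for \<open>F\<close>. Suppose that \<open>v\<close> lies outside the span \<open>U\<close> of the fixed points. The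
  shortest linear relation among \<open>v, F v, F\<^sup>2 v, \<dots>\<close> modulo \<open>U\<close> provides a \<open>w\<close> outside \<open>U\<close> with
  \<open>F w - w\<close> in \<open>U\<close>. As \<open>F - id\<close> maps \<open>U\<close> onto \<open>U\<close>, some \<open>u\<close> in \<open>U\<close> makes \<open>w + u\<close> a fixed point,
  which puts \<open>w\<close> into \<open>U\<close>.
\<close>

lemma subset_span_fixed_points: "V \<subseteq> span fixed_points"
proof (rule ccontr)
  let ?U = "span fixed_points" and ?p = "CHAR('k)"
  assume "\<not> ?thesis"
  then obtain v where v: "v \<in> V" "v \<notin> ?U" by blast
  define f where "f n = (F ^^ n) v" for n
  have fS: "F (f n) = f (Suc n)" for n by (simp add: f_def)
  have fV: "f n \<in> V" for n by (induction n) (auto simp: f_def v(1) F_in)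
  define R where "R n \<longleftrightarrow> (\<exists>a. \<exists>u\<in>?U. f n = (\<Sum>i<n. a i \<star> f i) + u)" for n
  have R_intro: "R n" if "f n = (\<Sum>i<n. a i \<star> f i) + u" "u \<in> ?U" for n a u
    unfolding R_def using that by (intro exI[of _ a] bexI[of _ u])
  have "\<exists>n. R n"
  proof -
    obtain n where "f n \<in> span (f ` {..<n})" using sequence_dependent by blast
    moreover have "\<exists>a. x = (\<Sum>i<n. a i \<star> f i)" if "x \<in> span (f ` {..<n})" for x
      using that
    proof (induction rule: span_induct_alt)
      case base
      then show ?case by (intro exI[of _ "\<lambda>_. 0"]) simp
    next
      case (step c x y)
      then obtain a j where a: "y = (\<Sum>i<n. a i \<star> f i)" and j: "j < n" "x = f j" by blast
      have "c \<star> x + y = (\<Sum>i<n. (if i = j then c else 0) \<star> f i) + (\<Sum>i<n. a i \<star> f i)"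
        using j by (simp add: a if_distrib[of "\<lambda>c. c \<star> _"] cong: if_cong)
      then have "c \<star> x + y = (\<Sum>i<n. ((if i = j then c else 0) + a i) \<star> f i)"
        by (simp add: scale_left_distrib sum.distrib)
      then show ?case by (intro exI[of _ "\<lambda>i. (if i = j then c else 0) + a i"])
    qed
    ultimately show ?thesis unfolding R_def using span_zero by (metis add.right_neutral)
  qed
  then obtain m where Rm: "R m" and least: "\<And>k. k < m \<Longrightarrow> \<not> R k"
    by (meson exists_least_iff)
  have "\<not> R 0" using v(2) by (auto simp: R_def f_def)
  then have "m \<noteq> 0" using Rm by metis
  then obtain k where m: "m = Suc k" using not0_implies_Suc by blast
  have nR: "\<not> R k" using least m by simp
  obtain a u where u: "u \<in> ?U" and a: "f (Suc k) = (\<Sum>i<Suc k. a i \<star> f i) + u"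
    using Rm unfolding m R_def by blast
  \<comment> \<open>If \<open>a 0 = 0\<close>, the relation is the image under \<open>F\<close> of a shorter one.\<close>
  have a0: "a 0 \<noteq> 0"
  proof
    assume a0: "a 0 = 0"
    have "F ` ?U = ?U"
      using image_eq_of_stable[OF subspace_span span_fixed_points_subset F_span_fixed_points] .
    then obtain u' where u': "u' \<in> ?U" "F u' = u" using u by (metis imageE)
    let ?s = "(\<Sum>i<k. frobenius_root (a (Suc i)) \<star> f i)"
    have sV: "?s \<in> V" using fV subspace_V by (auto intro: subspace_sum subspace_scale)
    have u'V: "u' \<in> V" using u'(1) span_fixed_points_subset by blast
    have "F ?s = (\<Sum>i<k. a (Suc i) \<star> f (Suc i))"
      using fV by (subst F_sum) (auto simp: frobenius_root_power fS)
    then have "F (?s + u') = F (f k)"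
      using u' sV u'V by (simp add: F_add fS a a0 sum.lessThan_Suc_shift del: sum.lessThan_Suc)
    then have "f k = ?s + u'"
      using F_inj_on fV sV u'V subspace_add[OF subspace_V] by (metis inj_onD)
    then have "R k" using u'(1) by (rule R_intro)
    then show False using nR by simp
  qed
  obtain c where ck: "c k \<noteq> 0" and c0: "c 0 = a 0 * c k ^ ?p"
    and cS: "\<And>i. i < k \<Longrightarrow> c (Suc i) = c i ^ ?p + a (Suc i) * c k ^ ?p"
    using frobenius_recurrence_solvable[where p = ?p and k = k and a = a, OF char_gt_1 a0] by blast
  define w where "w = (\<Sum>i<Suc k. c i \<star> f i)"
  have wV: "w \<in> V" unfolding w_def using fV subspace_V by (intro subspace_sum subspace_scale) auto
  have "F w = (\<Sum>i<k. c i ^ ?p \<star> f (Suc i)) + c k ^ ?p \<star> f (Suc k)"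
    unfolding w_def using fV by (subst F_sum) (auto simp: fS)
  also have "\<dots> = (\<Sum>i<k. c i ^ ?p \<star> f (Suc i)) + (\<Sum>i<Suc k. (c k ^ ?p * a i) \<star> f i) + c k ^ ?p \<star> u"
    unfolding a by (simp add: scale_right_distrib scale_sum_right)
  also have "\<dots> = w + c k ^ ?p \<star> u"
    unfolding w_def sum.lessThan_Suc_shift
    by (simp add: cS c0 scale_left_distrib sum.distrib mult.commute)
  finally have Fw: "F w - w = c k ^ ?p \<star> u" by simp
  then have "- (F w - w) \<in> ?U" using u by (simp add: span_neg span_scale)
  then obtain u0 where u0: "u0 \<in> ?U" "F u0 - u0 = - (F w - w)"
    using artin_schreier_on_span_fixed_points by blast
  have u0V: "u0 \<in> V" using u0(1) span_fixed_points_subset by blast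
  have "F (w + u0) = w + u0" using u0(2) wV u0V by (simp add: F_add algebra_simps)
  then have "w + u0 \<in> ?U"
    using wV u0V subspace_V by (intro span_base) (simp add: fixed_points_def subspace_add)
  then have wU: "w \<in> ?U" using u0(1) span_diff by fastforce
  have "c k \<star> f k = (\<Sum>i<k. (- c i) \<star> f i) + w" by (simp add: w_def sum_negf)
  then have "inverse (c k) \<star> (c k \<star> f k) = inverse (c k) \<star> ((\<Sum>i<k. (- c i) \<star> f i) + w)" by simp
  then have "f k = (\<Sum>i<k. (inverse (c k) * - c i) \<star> f i) + inverse (c k) \<star> w"
    using ck by (simp add: scale_right_distrib scale_sum_right)
  then have "R k" using span_scale[OF wU] by (rule R_intro)
  then show False using nR by simp
qed

lemma span_fixed_points: "span fixed_points = V"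
  using span_fixed_points_subset subset_span_fixed_points by blast

text \<open>
  So \<open>V\<close> has only finitely many \<open>F\<close>-stable subspaces: each of them is determined by a subset of the
  finite set of fixed points.
\<close>

lemma stable_subspace_eq_span:
  assumes "subspace W" "W \<subseteq> V" "F ` W \<subseteq> W"
  shows "span (W \<inter> fixed_points) = W"
proof -
  interpret W: frobenius_semilinear scale Basis W F
    using assms by unfold_locales (auto simp: char_pos subset_iff intro: F_add F_scale F_eq_0)
  have "W.fixed_points = W \<inter> fixed_points"
    using assms(2) by (auto simp: W.fixed_points_def fixed_points_def)
  then show ?thesis using W.span_fixed_points by simp
qed

end

section \<open>Tori and homomorphisms of restricted Lie algebras\<close>

context restricted_lie_algebra
begin

lemma brk_0_left: "brk L 0 y = 0"
  using brk_add_left[of 0 0 y] by simp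

lemma brk_0_right: "brk L x 0 = 0"
  using brk_add_right[of x 0 0] by simp

text \<open>
  The first of the \<open>p - 1\<close> brackets in Jacobson's formula already vanishes, being made up of
  \<open>[x, x]\<close> and \<open>[y, x]\<close>.
\<close>

lemma jacobson_commuting:
  assumes "brk L y x = 0" and i: "i \<in> {1..<CHAR('k)}"
  shows "jacobson L i x y = 0"
proof -
  let ?f = "\<lambda>n::nat. if n = 0 then y else if n = 1 then x else 0"
  let ?g = "\<lambda>n::nat. if n = 0 then x else 0"
  have ext_0: "ext_brk L ?f (\<lambda>_. 0) = (\<lambda>_. 0)"
    by (auto simp: ext_brk_def brk_0_right)
  have ext_x: "ext_brk L ?f ?g = (\<lambda>_. 0)"
    by (rule ext) (auto simp: ext_brk_def brk_0_left brk_0_right brk_self assms(1) intro!: sum.neutral)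
  have "(ext_brk L ?f ^^ Suc m) ?g = (\<lambda>_. 0)" for m
    by (induction m) (simp_all add: ext_0 ext_x)
  from this[of "CHAR('k) - 2"] have "(ext_brk L ?f ^^ (CHAR('k) - 1)) ?g = (\<lambda>_. 0)"
    using i by (simp add: numeral_2_eq_2 Suc_diff_Suc del: funpow.simps)
  then show ?thesis by (simp add: jacobson_def)
qed

lemma pmap_add_commuting: "brk L y x = 0 \<Longrightarrow> pmap L (x + y) = pmap L x + pmap L y"
  using pmap_add[of x y] by (simp add: jacobson_commuting)

lemma pmap_0: "CHAR('k) > 0 \<Longrightarrow> pmap L 0 = 0"
  using pmap_smult[of 0 0] by (simp add: zero_power)

lemma p_subalgebra_zero: "CHAR('k) > 0 \<Longrightarrow> p_subalgebra L {0}"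
  by (simp add: p_subalgebra_def brk_0_left pmap_0)

text \<open>
  By semisimplicity \<open>x\<close> lies in the \<open>p\<close>-subalgebra generated by \<open>pmap L x = 0\<close>.
\<close>

lemma torus_pmap_eq_0:
  assumes "CHAR('k) > 0" "torus L t" "x \<in> t" "pmap L x = 0"
  shows "x = 0"
proof -
  have "x \<in> p_subalgebra L hull {0}" using assms by (auto simp: torus_def semisimple_def)
  also have "\<dots> \<subseteq> {0}" by (rule hull_minimal) (simp_all add: p_subalgebra_zero assms(1))
  finally show ?thesis by simp
qed

end

lemma finite_dimensional_basis:
  assumes "restricted_lie_algebra L" "finite_dimensional L"
  obtains B where "finite_dimensional_vector_space (smult L) B"
proof -
  interpret restricted_lie_algebra L by fact
  obtain S where S: "finite S" "span S = UNIV" using assms(2) by (auto simp: finite_dimensional_def)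
  obtain B where B: "B \<subseteq> S" "independent B" "S \<subseteq> span B" by (rule maximal_independent_subset)
  have "finite_dimensional_vector_space (smult L) B"
  proof
    show "finite B" using B(1) S(1) by (rule finite_subset)
    show "independent B" by fact
    show "span B = UNIV" using B(3) S(2) span_mono span_span by (metis top.extremum_uniqueI)
  qed
  then show ?thesis using that by blast
qed

lemma frobenius_semilinear_pmap:
  fixes L :: "('k::alg_closed_field, 'g::ab_group_add) rlie"
  assumes "CHAR('k) > 0" "restricted_lie_algebra L" "finite_dimensional_vector_space (smult L) B"
    and "p_subalgebra L t" and "\<And>x y. x \<in> t \<Longrightarrow> y \<in> t \<Longrightarrow> brk L x y = 0"
    and "\<And>x. x \<in> t \<Longrightarrow> pmap L x = 0 \<Longrightarrow> x = 0"
  shows "frobenius_semilinear (smult L) B t (pmap L)"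
proof -
  interpret restricted_lie_algebra L by fact
  interpret finite_dimensional_vector_space "smult L" B by fact
  show ?thesis
    using assms(1,4-6)
    by unfold_locales (auto simp: p_subalgebra_def pmap_add_commuting pmap_smult)
qed

lemma frobenius_semilinear_torus:
  fixes L :: "('k::alg_closed_field, 'g::ab_group_add) rlie"
  assumes "CHAR('k) > 0" "restricted_lie_algebra L" "finite_dimensional_vector_space (smult L) B" "torus L t"
  shows "frobenius_semilinear (smult L) B t (pmap L)"
  using assms restricted_lie_algebra.torus_pmap_eq_0[OF assms(2,1,4)]
  by (intro frobenius_semilinear_pmap) (auto simp: torus_def)

text \<open>
  The \<open>p\<close>-map \<open>F\<close> permutes each \<open>F\<close>-stable subspace of \<open>t\<close>. If \<open>h\<close> is a \<open>p\<close>-subalgebra that contains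
  \<open>F x\<close>, then \<open>F x\<close> is the image of an element of \<open>h \<inter> t\<close>, which must be \<open>x\<close> by injectivity.
\<close>

lemma torus_if_pmap_injective:
  fixes L :: "('k::alg_closed_field, 'g::ab_group_add) rlie"
  assumes "CHAR('k) > 0" "restricted_lie_algebra L" "finite_dimensional L"
    and t: "p_subalgebra L t" "\<And>x y. x \<in> t \<Longrightarrow> y \<in> t \<Longrightarrow> brk L x y = 0"
    and inj: "\<And>x. x \<in> t \<Longrightarrow> pmap L x = 0 \<Longrightarrow> x = 0"
  shows "torus L t"
  unfolding torus_def
proof (intro conjI ballI)
  interpret restricted_lie_algebra L by fact
  obtain B where B: "finite_dimensional_vector_space (smult L) B"
    using finite_dimensional_basis assms(2,3) .
  interpret frobenius_semilinear "smult L" B t "pmap L"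
    using assms(1,2) B t inj by (rule frobenius_semilinear_pmap)
  show "semisimple L x" if x: "x \<in> t" for x
    unfolding semisimple_def hull_def
  proof clarify
    fix h assume h: "p_subalgebra L h" "{pmap L x} \<subseteq> h"
    have "subspace (h \<inter> t)"
      using h(1) t(1) by (auto simp: p_subalgebra_def intro: subspace_inter)
    moreover have "pmap L ` (h \<inter> t) \<subseteq> h \<inter> t" using h(1) t(1) by (auto simp: p_subalgebra_def)
    ultimately have "pmap L ` (h \<inter> t) = h \<inter> t" by (intro image_eq_of_stable) auto
    moreover have "pmap L x \<in> h \<inter> t" using h(2) x F_in by auto
    ultimately obtain y where "y \<in> h \<inter> t" "pmap L x = pmap L y" by (metis imageE)
    then have "x = y" using inj_onD[OF F_inj_on, of x y] x by blast
    then show "x \<in> h" using \<open>y \<in> h \<inter> t\<close> by blast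
  qed
qed (use t in auto)

text \<open>
  Homomorphisms out of the subalgebra \<open>t\<close>, with an arbitrary target and without the requirement that
  they be extensional, so that they can be composed with homomorphisms between the ambient algebras.
\<close>

definition rlie_hom_on ::
  "('k, 'g::ab_group_add) rlie \<Rightarrow> 'g set \<Rightarrow> ('k, 'h::ab_group_add) rlie \<Rightarrow> ('g \<Rightarrow> 'h) \<Rightarrow> bool" where
  "rlie_hom_on L t L' f \<longleftrightarrow> (\<forall>x\<in>t. \<forall>y\<in>t. f (x + y) = f x + f y) \<and>
     (\<forall>c. \<forall>x\<in>t. f (smult L c x) = smult L' c (f x)) \<and>
     (\<forall>x\<in>t. \<forall>y\<in>t. f (brk L x y) = brk L' (f x) (f y)) \<and> (\<forall>x\<in>t. f (pmap L x) = pmap L' (f x))"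

lemma rlie_hom_onD:
  assumes "rlie_hom_on L t L' f"
  shows "x \<in> t \<Longrightarrow> y \<in> t \<Longrightarrow> f (x + y) = f x + f y"
    and "x \<in> t \<Longrightarrow> f (smult L c x) = smult L' c (f x)"
    and "x \<in> t \<Longrightarrow> y \<in> t \<Longrightarrow> f (brk L x y) = brk L' (f x) (f y)"
    and "x \<in> t \<Longrightarrow> f (pmap L x) = pmap L' (f x)"
  using assms by (auto simp: rlie_hom_on_def)

lemma restricted_homs_iff: "\<phi> \<in> restricted_homs L t \<longleftrightarrow> \<phi> \<in> extensional t \<and> rlie_hom_on L t L \<phi>"
  by (auto simp: restricted_homs_def lin_maps_def rlie_hom_on_def)

lemma rlie_hom_on_trans:
  assumes "rlie_hom_on L t L' f" "rlie_hom_on L' t' L'' g" "f ` t \<subseteq> t'"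
  shows "rlie_hom_on L t L'' (\<lambda>x. g (f x))"
proof -
  have "f x \<in> t'" if "x \<in> t" for x using that assms(3) by blast
  then show ?thesis
    unfolding rlie_hom_on_def[of L t L'']
    by (simp add: rlie_hom_onD[OF assms(1)] rlie_hom_onD[OF assms(2)])
qed

lemma rlie_hom_on_comp:
  assumes "rlie_hom_on L t L' f" "rlie_hom_on L' UNIV L'' g"
  shows "rlie_hom_on L t L'' (\<lambda>x. g (f x))"
  using assms by (rule rlie_hom_on_trans) simp

context
  fixes L :: "('k::field, 'g::ab_group_add) rlie" and L' :: "('k, 'h::ab_group_add) rlie" and t f
  assumes L: "restricted_lie_algebra L" and L': "restricted_lie_algebra L'"
    and f: "rlie_hom_on L t L' f" and t: "p_subalgebra L t"
begin

interpretation L: restricted_lie_algebra L by (rule L)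
interpretation L': restricted_lie_algebra L' by (rule L')

lemma subspace_t: "L.subspace t" using t by (simp add: p_subalgebra_def)

lemma rlie_hom_on_0: "f 0 = 0"
  using rlie_hom_onD(1)[OF f, of 0 0] L.subspace_0[OF subspace_t] by simp

lemma p_subalgebra_vimage:
  assumes "p_subalgebra L' h"
  shows "p_subalgebra L {x \<in> t. f x \<in> h}"
  using assms t rlie_hom_on_0 rlie_hom_onD[OF f]
  by (auto simp: p_subalgebra_def L.subspace_def L'.subspace_def)

lemma p_subalgebra_image: "p_subalgebra L' (f ` t)"
  unfolding p_subalgebra_def L'.subspace_def
proof (intro conjI ballI allI; clarify?)
  show "0 \<in> f ` t" using rlie_hom_on_0 L.subspace_0[OF subspace_t] by (metis image_eqI)
  show "f x + f y \<in> f ` t" if "x \<in> t" "y \<in> t" for x y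
    using that L.subspace_add[OF subspace_t] rlie_hom_onD(1)[OF f] by (metis image_eqI)
  show "smult L' c (f x) \<in> f ` t" if "x \<in> t" for c x
    using that L.subspace_scale[OF subspace_t] rlie_hom_onD(2)[OF f] by (metis image_eqI)
  show "brk L' (f x) (f y) \<in> f ` t" if "x \<in> t" "y \<in> t" for x y
    using that t rlie_hom_onD(3)[OF f] by (metis image_eqI p_subalgebra_def)
  show "pmap L' (f x) \<in> f ` t" if "x \<in> t" for x
    using that t rlie_hom_onD(4)[OF f] by (metis image_eqI p_subalgebra_def)
qed

text \<open>
  If \<open>h\<close> is a \<open>p\<close>-subalgebra that contains the image of \<open>pmap L x\<close>, then its preimage in \<open>t\<close> is a
  \<open>p\<close>-subalgebra that contains \<open>pmap L x\<close>, hence \<open>x\<close>.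
\<close>

lemma torus_image:
  assumes tor: "torus L t"
  shows "torus L' (f ` t)"
  unfolding torus_def
proof (intro conjI ballI; clarify?)
  show "p_subalgebra L' (f ` t)" by (rule p_subalgebra_image)
  show "brk L' (f x) (f y) = 0" if "x \<in> t" "y \<in> t" for x y
    using that tor rlie_hom_on_0 rlie_hom_onD(3)[OF f] by (metis torus_def)
  show "semisimple L' (f x)" if x: "x \<in> t" for x
    unfolding semisimple_def hull_def
  proof clarify
    fix h assume h: "p_subalgebra L' h" "{pmap L' (f x)} \<subseteq> h"
    have "x \<in> p_subalgebra L hull {pmap L x}" using tor x by (simp add: torus_def semisimple_def)
    also have "\<dots> \<subseteq> {x \<in> t. f x \<in> h}"
    proof (rule hull_minimal)
      show "{pmap L x} \<subseteq> {x \<in> t. f x \<in> h}"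
        using x t h(2) rlie_hom_onD(4)[OF f] by (auto simp: p_subalgebra_def)
    qed (rule p_subalgebra_vimage[OF h(1)])
    finally show "f x \<in> h" by simp
  qed
qed

text \<open>
  Dimensions of images are available for maps that are linear on the whole space, whereas a
  homomorphism on \<open>t\<close> is arbitrary outside \<open>t\<close>.
\<close>

lemma linear_extension:
  obtains g where "Vector_Spaces.linear (smult L) (smult L') g" "\<And>x. x \<in> t \<Longrightarrow> g x = f x"
proof -
  interpret vector_space_pair "smult L" "smult L'" by unfold_locales
  obtain B where B: "B \<subseteq> t" "L.independent B" "t \<subseteq> L.span B"
    by (rule L.basis_exists)
  obtain g where g: "Vector_Spaces.linear (smult L) (smult L') g" "\<forall>x\<in>B. g x = f x"
    using linear_independent_extend[OF B(2)] by blast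
  interpret g: Vector_Spaces.linear "smult L" "smult L'" g by (rule g(1))
  have "x \<in> t \<and> g x = f x" if "x \<in> L.span B" for x
    using that
  proof (induction rule: L.span_induct_alt)
    case base
    then show ?case by (simp add: rlie_hom_on_0 g.zero L.subspace_0[OF subspace_t])
  next
    case (step c x y)
    then show ?case using B(1) g(2) subspace_t
      by (auto simp: rlie_hom_onD[OF f] L.subspace_add L.subspace_scale g.add g.scale)
  qed
  then show ?thesis using that g(1) B(3) by blast
qed

lemma dim_image:
  assumes fd: "finite_dimensional_vector_space (smult L) B" and inj: "inj_on f t"
    and S: "L.subspace S" "S \<subseteq> t"
  shows "L'.dim (f ` S) = L.dim S"
proof -
  obtain g where g: "Vector_Spaces.linear (smult L) (smult L') g" "\<And>x. x \<in> t \<Longrightarrow> g x = f x"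
    using linear_extension by blast
  interpret fd: finite_dimensional_vector_space "smult L" B by (rule fd)
  interpret finite_dimensional_vector_space_pair_1 "smult L" B "smult L'" by unfold_locales
  have span_S: "L.span S = S" using S(1) by (simp add: L.span_eq_iff)
  have "inj_on g S" using inj_on_subset[OF inj S(2)] g(2) S(2)
    by (metis inj_on_cong subsetD)
  then have "L'.dim (g ` S) = L.dim S" using dim_image_eq[OF g(1), of S] unfolding span_S by blast
  moreover have "g ` S = f ` S" using g(2) S(2) by (intro image_cong) auto
  ultimately show ?thesis by simp
qed

end

lemma torus_dim_le_rank:
  assumes "restricted_lie_algebra L" "finite_dimensional L" "torus L t"
  shows "vector_space.dim (smult L) t \<le> torus_rank L"
proof -
  obtain B where B: "finite_dimensional_vector_space (smult L) B"
    using finite_dimensional_basis assms(1,2) .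
  interpret finite_dimensional_vector_space "smult L" B by fact
  have "{dim t | t. torus L t} \<subseteq> {..dimension}" using dim_subset_UNIV by auto
  then have "finite {dim t | t. torus L t}" by (rule finite_subset) simp
  then show ?thesis unfolding torus_rank_def using assms(3) by (intro Max_ge) auto
qed

section \<open>The Zariski topology and the kernels of composed embeddings\<close>

lemma topspace_zariski: "topspace (zariski L t) = lin_maps L t"
proof -
  have "zariski_closed L t {}"
    unfolding zariski_closed_def by (intro exI[of _ "{\<lambda>_. 1}"]) (auto intro: poly_funs.const)
  then have "openin (zariski L t) (lin_maps L t)" by (simp add: openin_zariski)
  then show ?thesis by (metis openin_subset openin_topspace openin_zariski subset_antisym)
qed

lemma closedin_zariski: "closedin (zariski L t) C \<longleftrightarrow> zariski_closed L t C"
proof -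
  have "zariski_closed L t C \<Longrightarrow> C \<subseteq> lin_maps L t" by (auto simp: zariski_closed_def)
  then show ?thesis
    unfolding closedin_def topspace_zariski openin_zariski by (auto simp: double_diff)
qed

text \<open>
  Pulling functions back along \<open>\<Phi>\<close> respects sums and products, so it suffices to pull back the
  matrix coefficients, which generate the polynomial functions.
\<close>

lemma continuous_map_zariski:
  fixes L :: "('k::field, 'g::ab_group_add) rlie" and L' :: "('k, 'h::ab_group_add) rlie"
  assumes maps: "\<Phi> \<in> lin_maps L t \<rightarrow> lin_maps L' t'"
    and poly: "\<And>l x. Vector_Spaces.linear (smult L') (*) l \<Longrightarrow> x \<in> t' \<Longrightarrow> (\<lambda>\<phi>. l (\<Phi> \<phi> x)) \<in> poly_funs L t"
  shows "continuous_map (zariski L t) (zariski L' t') \<Phi>"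
  unfolding continuous_map_closedin topspace_zariski closedin_zariski
proof (intro conjI allI impI)
  show "\<Phi> \<in> lin_maps L t \<rightarrow> lin_maps L' t'" by (rule maps)
next
  fix C assume "zariski_closed L' t' C"
  then obtain F where F: "F \<subseteq> poly_funs L' t'" "C = {\<phi> \<in> lin_maps L' t'. \<forall>f\<in>F. f \<phi> = 0}"
    unfolding zariski_closed_def by blast
  have "(\<lambda>\<phi>. f (\<Phi> \<phi>)) \<in> poly_funs L t" if "f \<in> poly_funs L' t'" for f
    using that by induction (auto intro: poly poly_funs.intros)
  then have "(\<lambda>f \<phi>. f (\<Phi> \<phi>)) ` F \<subseteq> poly_funs L t" using F(1) by auto
  moreover have "{\<phi> \<in> lin_maps L t. \<Phi> \<phi> \<in> C} =
      {\<phi> \<in> lin_maps L t. \<forall>f\<in>(\<lambda>f \<phi>. f (\<Phi> \<phi>)) ` F. f \<phi> = 0}"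
    using maps F(2) by auto
  ultimately show "zariski_closed L t {\<phi> \<in> lin_maps L t. \<Phi> \<phi> \<in> C}"
    unfolding zariski_closed_def by blast
qed

lemma vector_space_mult: "vector_space ((*) :: 'k::field \<Rightarrow> 'k \<Rightarrow> 'k)"
  by unfold_locales (simp_all add: algebra_simps)

lemma (in vector_space) exists_functional:
  assumes "v \<noteq> 0"
  shows "\<exists>l. Vector_Spaces.linear scale (*) l \<and> l v \<noteq> 0"
proof -
  interpret K: vector_space "(*) :: 'a \<Rightarrow> 'a \<Rightarrow> 'a" by (rule vector_space_mult)
  interpret vector_space_pair scale "(*) :: 'a \<Rightarrow> 'a \<Rightarrow> 'a" by unfold_locales
  have "independent {v}" using assms by simp
  then obtain l where "Vector_Spaces.linear scale (*) l" "\<forall>x\<in>{v}. l x = 1"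
    using linear_independent_extend[of "{v}" "\<lambda>_. 1"] by blast
  then show ?thesis by (intro exI[of _ l]) auto
qed

context
  fixes L :: "('k::alg_closed_field, 'g::ab_group_add) rlie" and L' :: "('k, 'h::ab_group_add) rlie"
    and t :: "'g set" and \<pi> :: "'g \<Rightarrow> 'h"
  assumes L: "restricted_lie_algebra L" and L': "restricted_lie_algebra L'"
    and \<pi>: "rlie_hom_on L UNIV L' \<pi>"
begin

interpretation L: restricted_lie_algebra L by (rule L)
interpretation L': restricted_lie_algebra L' by (rule L')

text \<open>
  The functionals \<open>l \<circ> \<pi>\<close>, with \<open>l\<close> linear on the target of \<open>\<pi>\<close>, cut out the condition, because linear
  functionals separate points.
\<close>

lemma closedin_vanishing:
  assumes E: "E \<subseteq> t"
  shows "closedin (zariski L t) {\<phi> \<in> lin_maps L t. \<forall>x\<in>E. \<pi> (\<phi> x) = 0}"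
proof -
  define F where
    "F = {\<lambda>\<phi>::'g \<Rightarrow> 'g. (l \<circ> \<pi>) (\<phi> x) | l x. Vector_Spaces.linear (smult L') (*) l \<and> x \<in> E}"
  have "Vector_Spaces.linear (smult L) (smult L') \<pi>"
    using rlie_hom_onD(1,2)[OF \<pi>] by unfold_locales auto
  then have "F \<subseteq> poly_funs L t"
    using E unfolding F_def
    by (auto intro!: poly_funs.coeff[of L] intro: Vector_Spaces.linear_compose simp del: o_apply)
  moreover have "{\<phi> \<in> lin_maps L t. \<forall>x\<in>E. \<pi> (\<phi> x) = 0} = {\<phi> \<in> lin_maps L t. \<forall>f\<in>F. f \<phi> = 0}"
  proof -
    have "(\<forall>x\<in>E. \<pi> (\<phi> x) = 0) \<longleftrightarrow> (\<forall>f\<in>F. f \<phi> = 0)" for \<phi>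
    proof
      assume *: "\<forall>x\<in>E. \<pi> (\<phi> x) = 0"
      show "\<forall>f\<in>F. f \<phi> = 0"
      proof
        fix f assume "f \<in> F"
        then obtain l x where l: "Vector_Spaces.linear (smult L') (*) l" "x \<in> E" "f = (\<lambda>\<phi>. (l \<circ> \<pi>) (\<phi> x))"
          unfolding F_def by blast
        interpret l: Vector_Spaces.linear "smult L'" "(*)" l by (rule l(1))
        show "f \<phi> = 0" using * l(2,3) by (simp add: l.zero)
      qed
    next
      assume *: "\<forall>f\<in>F. f \<phi> = 0"
      show "\<forall>x\<in>E. \<pi> (\<phi> x) = 0"
      proof (rule ballI, rule ccontr)
        fix x assume x: "x \<in> E" "\<pi> (\<phi> x) \<noteq> 0"
        then obtain l where "Vector_Spaces.linear (smult L') (*) l" "l (\<pi> (\<phi> x)) \<noteq> 0"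
          using L'.exists_functional by blast
        then show False using * x(1) unfolding F_def by force
      qed
    qed
    then show ?thesis by blast
  qed
  ultimately show ?thesis unfolding closedin_zariski zariski_closed_def by blast
qed

text \<open>
  Let \<open>K \<phi>\<close> be the kernel of \<open>\<pi> \<circ> \<phi>\<close> on \<open>t\<close>, and \<open>A E\<close> the closed set of all \<open>\<phi>\<close> such that \<open>\<pi> \<circ> \<phi>\<close>
  vanishes on \<open>E\<close>. Because the kernels have equal dimensions, \<open>A (K \<phi>)\<close> consists of the embeddings
  with the same kernel as \<open>\<phi>\<close>, so these sets form a partition. A kernel is spanned by the fixed points
  of the \<open>p\<close>-map that it contains, so there are finitely many kernels and the partition is finite. Its
  members are therefore open as well as closed.
\<close>

lemma kernel_constant_on_component:
  assumes char: "CHAR('k) > 0" and fd: "finite_dimensional L" and t: "torus L t"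
    and dim: "\<And>\<phi>. \<phi> \<in> torus_embeddings L t \<Longrightarrow> L.dim {x \<in> t. \<pi> (\<phi> x) = 0} = n"
    and conn: "connected_component_of (subtopology (zariski L t) (torus_embeddings L t)) a b"
  shows "{x \<in> t. \<pi> (a x) = 0} = {x \<in> t. \<pi> (b x) = 0}"
proof -
  let ?T = "torus_embeddings L t" and ?X = "subtopology (zariski L t) (torus_embeddings L t)"
  obtain B where B: "finite_dimensional_vector_space (smult L) B"
    using finite_dimensional_basis L fd .
  interpret frobenius_semilinear "smult L" B t "pmap L"
    using char L B t by (rule frobenius_semilinear_torus)
  define K where "K \<phi> = {x \<in> t. \<pi> (\<phi> x) = 0}" for \<phi>
  define A where "A E = {\<phi> \<in> ?T. \<forall>x\<in>E. \<pi> (\<phi> x) = 0}" for E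
  have pt: "p_subalgebra L t" using t by (simp add: torus_def)
  have T_lin: "?T \<subseteq> lin_maps L t" by (auto simp: torus_embeddings_def restricted_homs_def)
  then have topX: "topspace ?X = ?T" by (simp add: topspace_zariski Int_absorb1)
  have closed_A: "closedin ?X (A E)" if "E \<subseteq> t" for E
  proof -
    have "A E = {\<phi> \<in> lin_maps L t. \<forall>x\<in>E. \<pi> (\<phi> x) = 0} \<inter> ?T" using T_lin by (auto simp: A_def)
    then show ?thesis using closedin_vanishing[OF that] by (auto simp: closedin_subtopology)
  qed
  have K_p: "p_subalgebra L (K \<phi>)" if "\<phi> \<in> ?T" for \<phi>
  proof -
    have "rlie_hom_on L t L' (\<lambda>x. \<pi> (\<phi> x))"
      using that by (intro rlie_hom_on_comp[OF _ \<pi>]) (simp add: torus_embeddings_def restricted_homs_iff)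
    from p_subalgebra_vimage[OF L L' this pt L'.p_subalgebra_zero[OF char]]
    show ?thesis by (simp add: K_def)
  qed
  have K_sub: "L.subspace (K \<phi>)" if "\<phi> \<in> ?T" for \<phi>
    using K_p[OF that] by (simp add: p_subalgebra_def)
  have K_span: "L.span (K \<phi> \<inter> fixed_points) = K \<phi>" if "\<phi> \<in> ?T" for \<phi>
    using K_p[OF that] by (intro stable_subspace_eq_span) (auto simp: p_subalgebra_def K_def)
  have A_fixed: "A (K \<phi> \<inter> fixed_points) = A (K \<phi>)" if "\<phi> \<in> ?T" for \<phi>
  proof -
    have "K \<phi> \<subseteq> K \<psi>" if \<psi>: "\<psi> \<in> A (K \<phi> \<inter> fixed_points)" for \<psi>
    proof -
      have \<psi>T: "\<psi> \<in> ?T" using \<psi> by (simp add: A_def)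
      have "K \<phi> \<inter> fixed_points \<subseteq> K \<psi>" using \<psi> by (auto simp: A_def K_def)
      then have "L.span (K \<phi> \<inter> fixed_points) \<subseteq> K \<psi>" by (rule L.span_minimal) (rule K_sub[OF \<psi>T])
      then show ?thesis by (simp add: K_span \<open>\<phi> \<in> ?T\<close>)
    qed
    then show ?thesis by (fastforce simp: A_def K_def)
  qed
  have K_eq: "K \<phi> = K \<psi>" if "\<phi> \<in> ?T" "\<psi> \<in> A (K \<phi>)" for \<phi> \<psi>
  proof (rule subspace_dim_equal)
    have \<psi>: "\<psi> \<in> ?T" using that(2) by (simp add: A_def)
    show "L.subspace (K \<phi>)" "L.subspace (K \<psi>)" using K_sub that(1) \<psi> by auto
    show "K \<phi> \<subseteq> K \<psi>" using that(2) by (auto simp: A_def K_def)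
    show "L.dim (K \<psi>) \<le> L.dim (K \<phi>)" using dim that(1) \<psi> by (simp add: K_def)
  qed
  have self: "\<phi> \<in> A (K \<phi>)" if "\<phi> \<in> ?T" for \<phi> using that by (auto simp: A_def K_def)
  have aT: "a \<in> ?T" using connected_component_in_topspace[OF conn] topX by simp
  \<comment> \<open>Indexing the closed sets by sets of fixed points exhibits their union as a finite one.\<close>
  define \<C> where "\<C> = (\<lambda>c. K c \<inter> fixed_points) ` (?T - A (K a))"
  have "?T - A (K a) = \<Union>(A ` \<C>)"
  proof -
    have "A (K c) \<inter> A (K a) = {}" if "c \<in> ?T - A (K a)" for c
    proof -
      have "K c = K a" if "d \<in> A (K c)" "d \<in> A (K a)" for d
        using K_eq that aT \<open>c \<in> ?T - A (K a)\<close> by blast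
      then show ?thesis using that self by fastforce
    qed
    moreover have "A E \<subseteq> ?T" for E by (auto simp: A_def)
    moreover have "A ` \<C> = (\<lambda>c. A (K c)) ` (?T - A (K a))"
      unfolding \<C>_def image_image using A_fixed by (intro image_cong) auto
    ultimately show ?thesis using self by auto
  qed
  moreover have "finite \<C>"
    by (rule finite_subset[of _ "Pow fixed_points"]) (auto simp: \<C>_def finite_fixed_points)
  then have "closedin ?X (\<Union>(A ` \<C>))"
    by (intro closedin_Union) (auto simp: \<C>_def K_def intro!: closed_A)
  ultimately have "closedin ?X (?T - A (K a))" by simp
  then have "openin ?X (A (K a))"
    unfolding openin_closedin_eq topX by (auto simp: A_def)
  moreover have "closedin ?X (A (K a))" by (rule closed_A) (auto simp: K_def)
  moreover obtain S where "connectedin ?X S" "a \<in> S" "b \<in> S"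
    using conn by (auto simp: connected_component_of_def)
  ultimately have "b \<in> A (K a)"
    using connectedin_clopen_cases[of ?X S "A (K a)"] self[OF aT] by (auto simp: disjnt_iff)
  then show ?thesis using K_eq[OF aT] by (simp add: K_def)
qed

end

section \<open>The stabilizer as a set of automorphisms in the component\<close>

lemma torus_embeddings_iff:
  "\<phi> \<in> torus_embeddings L t \<longleftrightarrow> \<phi> \<in> extensional t \<and> rlie_hom_on L t L \<phi> \<and> inj_on \<phi> t"
  by (auto simp: torus_embeddings_def restricted_homs_iff)

lemma torus_embeddings_subset_lin_maps: "torus_embeddings L t \<subseteq> lin_maps L t"
  by (auto simp: torus_embeddings_def restricted_homs_def)

lemma topspace_embeddings:
  "topspace (subtopology (zariski L t) (torus_embeddings L t)) = torus_embeddings L t"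
  using torus_embeddings_subset_lin_maps[of L t] by (simp add: topspace_zariski Int_absorb1)

lemma embedding_component_subset: "embedding_component L t \<subseteq> torus_embeddings L t"
  using connected_component_of_subset_topspace[of "subtopology (zariski L t) (torus_embeddings L t)" "\<lambda>x\<in>t. x"]
  unfolding embedding_component_def topspace_embeddings .

lemma carrier_Aut_p: "carrier (Aut_p L t) = restricted_homs L t \<inter> Bij t"
  by (simp add: Aut_p_def)

lemma mult_Aut_p:
  "h \<in> carrier (Aut_p L t) \<Longrightarrow> k \<in> carrier (Aut_p L t) \<Longrightarrow> h \<otimes>\<^bsub>Aut_p L t\<^esub> k = compose t h k"
  by (simp add: Aut_p_def BijGroup_def)

context restricted_lie_algebra
begin

context
  fixes t assumes t: "p_subalgebra L t"
begin

lemma p_subalgebra_closed: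
  shows "x \<in> t \<Longrightarrow> y \<in> t \<Longrightarrow> x + y \<in> t" and "x \<in> t \<Longrightarrow> smult L c x \<in> t"
    and "x \<in> t \<Longrightarrow> y \<in> t \<Longrightarrow> brk L x y \<in> t" and "x \<in> t \<Longrightarrow> pmap L x \<in> t"
  using t by (auto simp: p_subalgebra_def subspace_add subspace_scale)

lemma rlie_hom_on_restrict: "rlie_hom_on L t L' f \<Longrightarrow> rlie_hom_on L t L' (restrict f t)"
  unfolding rlie_hom_on_def[of L t L' "restrict f t"]
  by (simp add: rlie_hom_onD[of L t L' f] p_subalgebra_closed)

lemma rlie_hom_on_compose:
  assumes "rlie_hom_on L t L \<phi>" "rlie_hom_on L t L k" "k ` t \<subseteq> t"
  shows "rlie_hom_on L t L (compose t \<phi> k)"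
  using assms by (simp add: rlie_hom_on_def compose_def p_subalgebra_closed image_subset_iff)

lemma rlie_hom_on_inverse:
  assumes h: "rlie_hom_on L t L h" "bij_betw h t t"
  shows "rlie_hom_on L t L (\<lambda>x\<in>t. inv_into t h x)"
proof -
  let ?k = "inv_into t h"
  have k_in: "?k x \<in> t" if "x \<in> t" for x using that h(2) bij_betw_def inv_into_into by metis
  have hk: "h (?k x) = x" if "x \<in> t" for x using that h(2) bij_betw_inv_into_right by metis
  have k_eq: "?k y = x" if "x \<in> t" "h x = y" for x y
    using that h(2) by (metis bij_betw_inv_into_left)
  show ?thesis
    using k_in hk
    by (auto simp: rlie_hom_on_def p_subalgebra_closed rlie_hom_onD[OF h(1)] intro!: k_eq)
qed

lemma subgroup_restricted_automorphisms: "subgroup (restricted_homs L t \<inter> Bij t) (BijGroup t)"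
proof (rule subgroup.intro)
  show "restricted_homs L t \<inter> Bij t \<subseteq> carrier (BijGroup t)" by (simp add: BijGroup_def)
next
  fix h k assume "h \<in> restricted_homs L t \<inter> Bij t" "k \<in> restricted_homs L t \<inter> Bij t"
  then show "h \<otimes>\<^bsub>BijGroup t\<^esub> k \<in> restricted_homs L t \<inter> Bij t"
    using Bij_imp_funcset[of k t]
    by (auto simp: BijGroup_def compose_Bij restricted_homs_iff intro!: rlie_hom_on_compose)
next
  show "\<one>\<^bsub>BijGroup t\<^esub> \<in> restricted_homs L t \<inter> Bij t"
    by (auto simp: BijGroup_def id_Bij restricted_homs_iff rlie_hom_on_def p_subalgebra_closed)
next
  fix h assume h: "h \<in> restricted_homs L t \<inter> Bij t"
  then have "(\<lambda>x\<in>t. inv_into t h x) \<in> restricted_homs L t"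
    unfolding restricted_homs_iff by (auto intro!: rlie_hom_on_inverse simp: Bij_def restricted_homs_iff)
  then show "inv\<^bsub>BijGroup t\<^esub> h \<in> restricted_homs L t \<inter> Bij t"
    using h restrict_inv_into_Bij[of h t] by (simp add: inv_BijGroup)
qed

lemma group_Aut_p: "group (Aut_p L t)"
  unfolding Aut_p_def
  using subgroup.subgroup_is_group[OF subgroup_restricted_automorphisms group_BijGroup] .

lemma inclusion_embedding: "(\<lambda>x\<in>t. x) \<in> torus_embeddings L t"
  by (auto simp: torus_embeddings_iff rlie_hom_on_def p_subalgebra_closed inj_on_def)

lemma compose_continuous:
  assumes k: "k \<in> carrier (Aut_p L t)"
  shows "continuous_map (subtopology (zariski L t) (torus_embeddings L t))
    (subtopology (zariski L t) (torus_embeddings L t)) (\<lambda>\<phi>. compose t \<phi> k)"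
proof -
  have k_in: "k x \<in> t" if "x \<in> t" for x
    using k that Bij_imp_funcset[of k t] by (auto simp: carrier_Aut_p)
  have k_hom: "rlie_hom_on L t L k" and k_bij: "bij_betw k t t"
    using k by (auto simp: carrier_Aut_p restricted_homs_iff Bij_def)
  have "continuous_map (zariski L t) (zariski L t) (\<lambda>\<phi>. compose t \<phi> k)"
  proof (rule continuous_map_zariski)
    show "(\<lambda>\<phi>. compose t \<phi> k) \<in> lin_maps L t \<rightarrow> lin_maps L t"
      using k_in rlie_hom_onD[OF k_hom]
      by (auto simp: lin_maps_def compose_def p_subalgebra_closed)
    show "(\<lambda>\<phi>. l (compose t \<phi> k x)) \<in> poly_funs L t"
      if "Vector_Spaces.linear (smult L) (*) l" "x \<in> t" for l x
      using that poly_funs.coeff[OF that(1) k_in[OF that(2)]] by (simp add: compose_eq)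
  qed
  moreover have "compose t \<phi> k \<in> torus_embeddings L t" if "\<phi> \<in> torus_embeddings L t" for \<phi>
    using that k_in k_hom bij_betw_imp_inj_on[OF k_bij]
    by (auto simp: torus_embeddings_iff inj_on_def compose_eq intro!: rlie_hom_on_compose)
  ultimately show ?thesis
    by (auto simp: continuous_map_in_subtopology topspace_embeddings intro: continuous_map_from_subtopology)
qed

text \<open>
  If \<open>\<phi>\<close> is joined to the inclusion, then \<open>\<phi> \<circ> k\<close> is joined to \<open>k\<close>, so precomposition with an
  automorphism \<open>k\<close> in the component of the inclusion preserves that component. Conversely, an
  automorphism \<open>h\<close> that stabilizes the component moves the inclusion to the inverse of \<open>h\<close>, which
  therefore lies in the component, and then so does \<open>h\<close>.
\<close>

lemma carrier_S_group: "carrier (S_group L t) = carrier (Aut_p L t) \<inter> embedding_component L t"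
proof -
  interpret Aut: group "Aut_p L t" by (rule group_Aut_p)
  let ?A = "carrier (Aut_p L t)" and ?X = "embedding_component L t" and ?i = "\<lambda>x\<in>t. x"
  define C where "C = connected_component_of (subtopology (zariski L t) (torus_embeddings L t))"
  have X: "\<phi> \<in> ?X \<longleftrightarrow> C ?i \<phi>" for \<phi> by (simp add: embedding_component_def C_def)
  have C_sym: "C a b \<Longrightarrow> C b a" and C_trans: "C a b \<Longrightarrow> C b c \<Longrightarrow> C a c" for a b c
    unfolding C_def by (metis connected_component_of_sym, metis connected_component_of_trans)
  have C_comp: "C (compose t a k) (compose t b k)" if "k \<in> ?A" "C a b" for a b k
    using connected_component_of_continuous_image[OF compose_continuous[OF that(1)]] that(2)
    unfolding C_def by blast
  have X_ext: "\<phi> \<in> extensional t" if "\<phi> \<in> ?X" for \<phi>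
    using that embedding_component_subset torus_embeddings_iff by blast
  have i_X: "?i \<in> ?X"
    unfolding X C_def connected_component_of_refl topspace_embeddings by (rule inclusion_embedding)
  have ext: "h \<in> extensional t" and maps: "h \<in> t \<rightarrow> t" if "h \<in> ?A" for h
    using that Bij_imp_extensional[of h t] Bij_imp_funcset[of h t] by (auto simp: carrier_Aut_p)
  have one: "\<one>\<^bsub>Aut_p L t\<^esub> = ?i" by (simp add: Aut_p_def BijGroup_def)
  have i_comp: "compose t ?i h = h" if "h \<in> ?A" for h using ext[OF that] maps[OF that] by simp
  have inv: "compose t h (inv\<^bsub>Aut_p L t\<^esub> h) = ?i" "compose t (inv\<^bsub>Aut_p L t\<^esub> h) h = ?i" if "h \<in> ?A" for h
    using that Aut.r_inv[of h] Aut.l_inv[of h] by (simp_all add: mult_Aut_p one)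
  have in_X_iff: "inv\<^bsub>Aut_p L t\<^esub> h \<in> ?X \<longleftrightarrow> h \<in> ?X" if "h \<in> ?A" for h
  proof -
    have "C ?i (inv\<^bsub>Aut_p L t\<^esub> k)" if "k \<in> ?A" "C ?i k" for k
      using C_comp[OF Aut.inv_closed[OF that(1)] that(2)] inv(1)[OF that(1)]
        i_comp[OF Aut.inv_closed[OF that(1)]] C_sym by metis
    then show ?thesis using that Aut.inv_closed[OF that] Aut.inv_inv[OF that] unfolding X by metis
  qed
  have stab: "aut_action L t h ` ?X = ?X \<longleftrightarrow> h \<in> ?X" if h: "h \<in> ?A" for h
  proof
    assume "aut_action L t h ` ?X = ?X"
    then have "aut_action L t h ?i \<in> ?X" using i_X by blast
    then show "h \<in> ?X" using h in_X_iff i_comp[OF Aut.inv_closed[OF h]] by (simp add: aut_action_def)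
  next
    assume hX: "h \<in> ?X"
    have stable: "compose t \<phi> k \<in> ?X" if "k \<in> ?A" "k \<in> ?X" "\<phi> \<in> ?X" for k \<phi>
      using C_comp[of k ?i \<phi>] that C_trans i_comp unfolding X by metis
    let ?k = "inv\<^bsub>Aut_p L t\<^esub> h"
    have k: "?k \<in> ?A" "?k \<in> ?X" using h hX in_X_iff by auto
    show "aut_action L t h ` ?X = ?X"
    proof (intro equalityI subsetI)
      fix \<phi> assume "\<phi> \<in> aut_action L t h ` ?X"
      then show "\<phi> \<in> ?X" using stable[OF k] by (auto simp: aut_action_def)
    next
      fix \<phi> assume \<phi>: "\<phi> \<in> ?X"
      have "compose t (compose t \<phi> h) ?k = compose t \<phi> (compose t h ?k)"
        using compose_assoc[OF maps[OF k(1)], of \<phi> h] by simp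
      moreover have "compose t \<phi> ?i = \<phi>"
        using X_ext[OF \<phi>] by (auto simp: compose_def extensional_def)
      ultimately have "\<phi> = aut_action L t h (compose t \<phi> h)"
        using inv(1)[OF h] by (simp add: aut_action_def)
      then show "\<phi> \<in> aut_action L t h ` ?X" using stable[OF h hX \<phi>] by (rule image_eqI)
    qed
  qed
  show ?thesis using stab by (auto simp: S_group_def stabilizer_def)
qed

lemma mult_S_group:
  "h \<in> carrier (S_group L t) \<Longrightarrow> k \<in> carrier (S_group L t) \<Longrightarrow> h \<otimes>\<^bsub>S_group L t\<^esub> k = compose t h k"
  using mult_Aut_p[of h L t k] by (simp add: carrier_S_group) (simp add: S_group_def)

end

end

section \<open>Direct sums\<close>

lemma direct_sum_simps [simp]:
  "smult (L1 \<oplus>\<^sub>L L2) c z = (smult L1 c (fst z), smult L2 c (snd z))"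
  "brk (L1 \<oplus>\<^sub>L L2) z w = (brk L1 (fst z) (fst w), brk L2 (snd z) (snd w))"
  "pmap (L1 \<oplus>\<^sub>L L2) z = (pmap L1 (fst z), pmap L2 (snd z))"
  by (simp_all add: direct_sum_def case_prod_beta)

lemma rlie_hom_on_fst: "rlie_hom_on (L1 \<oplus>\<^sub>L L2) UNIV L1 fst"
  and rlie_hom_on_snd: "rlie_hom_on (L1 \<oplus>\<^sub>L L2) UNIV L2 snd"
  by (auto simp: rlie_hom_on_def)

definition pair_map :: "'a set \<Rightarrow> 'b set \<Rightarrow> ('a \<Rightarrow> 'a) \<Rightarrow> ('b \<Rightarrow> 'b) \<Rightarrow> 'a \<times> 'b \<Rightarrow> 'a \<times> 'b" where
  "pair_map t1 t2 a b = restrict (map_prod a b) (t1 \<times> t2)"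

definition fst_block :: "'a set \<Rightarrow> ('a \<times> 'b::zero \<Rightarrow> 'a \<times> 'b) \<Rightarrow> 'a \<Rightarrow> 'a" where
  "fst_block t1 \<phi> = (\<lambda>x\<in>t1. fst (\<phi> (x, 0)))"

definition snd_block :: "'b set \<Rightarrow> ('a::zero \<times> 'b \<Rightarrow> 'a \<times> 'b) \<Rightarrow> 'b \<Rightarrow> 'b" where
  "snd_block t2 \<phi> = (\<lambda>y\<in>t2. snd (\<phi> (0, y)))"

lemma pair_map_apply [simp]: "x \<in> t1 \<Longrightarrow> y \<in> t2 \<Longrightarrow> pair_map t1 t2 a b (x, y) = (a x, b y)"
  by (simp add: pair_map_def)

lemma pair_map_extensional: "pair_map t1 t2 a b \<in> extensional (t1 \<times> t2)"
  by (simp add: pair_map_def)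

lemma compose_pair_map:
  assumes "c ` t1 \<subseteq> t1" "d ` t2 \<subseteq> t2"
  shows "compose (t1 \<times> t2) (pair_map t1 t2 a b) (pair_map t1 t2 c d) =
    pair_map t1 t2 (compose t1 a c) (compose t2 b d)"
  using assms by (auto simp: compose_def pair_map_def fun_eq_iff image_subset_iff)

locale direct_sum_tori =
  L1: restricted_lie_algebra L1 + L2: restricted_lie_algebra L2
  for L1 :: "('k::alg_closed_field, 'a::ab_group_add) rlie"
    and L2 :: "('k, 'b::ab_group_add) rlie" +
  fixes t1 :: "'a set" and t2 :: "'b set"
  assumes char_pos: "CHAR('k) > 0"
    and fd1: "finite_dimensional L1" and fd2: "finite_dimensional L2"
    and max1: "maximal_dim_torus L1 t1" and max2: "maximal_dim_torus L2 t2"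
begin

abbreviation "L \<equiv> L1 \<oplus>\<^sub>L L2"
abbreviation "t \<equiv> t1 \<times> t2"

sublocale L: restricted_lie_algebra L
  by (rule restricted_lie_algebra_direct_sum) unfold_locales

lemma torus_t1: "torus L1 t1" and torus_t2: "torus L2 t2"
  using max1 max2 by (simp_all add: maximal_dim_torus_def)

lemma p_subalgebra_t1: "p_subalgebra L1 t1" and p_subalgebra_t2: "p_subalgebra L2 t2"
  using torus_t1 torus_t2 by (simp_all add: torus_def)

lemma subspace_t1: "L1.subspace t1" and subspace_t2: "L2.subspace t2"
  using p_subalgebra_t1 p_subalgebra_t2 by (simp_all add: p_subalgebra_def)

lemma zero_in [simp]: "0 \<in> t1" "0 \<in> t2"
  using L1.subspace_0 subspace_t1 L2.subspace_0 subspace_t2 by blast+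

lemma subspace_Times:
  assumes "L1.subspace A" "L2.subspace B"
  shows "L.subspace (A \<times> B)"
  using assms by (auto simp: L.subspace_def L1.subspace_def L2.subspace_def zero_prod_def)

lemma basis_of_sum: "\<exists>B. finite_dimensional_vector_space (smult L) B"
  and dim_Times: "L1.subspace A \<Longrightarrow> L2.subspace B \<Longrightarrow> L.dim (A \<times> B) = L1.dim A + L2.dim B"
proof -
  obtain B1 where "finite_dimensional_vector_space (smult L1) B1"
    using finite_dimensional_basis L1.restricted_lie_algebra_axioms fd1 .
  then interpret F1: finite_dimensional_vector_space "smult L1" B1 .
  obtain B2 where "finite_dimensional_vector_space (smult L2) B2"
    using finite_dimensional_basis L2.restricted_lie_algebra_axioms fd2 .
  then interpret F2: finite_dimensional_vector_space "smult L2" B2 .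
  interpret P: finite_dimensional_vector_space_prod "smult L1" "smult L2" B1 B2 by unfold_locales
  have s: "P.scale = smult L" by (intro ext) (simp add: P.scale_def)
  show "\<exists>B. finite_dimensional_vector_space (smult L) B"
    using P.p.finite_dimensional_vector_space_axioms unfolding s by blast
  show "L.dim (A \<times> B) = L1.dim A + L2.dim B" if "L1.subspace A" "L2.subspace B"
    using P.dim_Times[OF that] unfolding s .
qed

lemma fd: "finite_dimensional L"
proof -
  obtain B where "finite_dimensional_vector_space (smult L) B" using basis_of_sum by blast
  then interpret finite_dimensional_vector_space "smult L" B .
  show ?thesis unfolding finite_dimensional_def using finite_Basis span_Basis by blast
qed

lemma dim_le_rank:
  "torus L1 s \<Longrightarrow> L1.dim s \<le> L1.dim t1" "torus L2 s' \<Longrightarrow> L2.dim s' \<le> L2.dim t2"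
  using max1 max2 torus_dim_le_rank[OF L1.restricted_lie_algebra_axioms fd1]
    torus_dim_le_rank[OF L2.restricted_lie_algebra_axioms fd2]
  by (simp_all add: maximal_dim_torus_def)

lemma torus_fst: "torus L1 (fst ` s)" and torus_snd: "torus L2 (snd ` s)" if s: "torus L s"
proof -
  note Lax = L.restricted_lie_algebra_axioms L1.restricted_lie_algebra_axioms L2.restricted_lie_algebra_axioms
  have p: "p_subalgebra L s" using s by (simp add: torus_def)
  have "rlie_hom_on L s L1 fst" "rlie_hom_on L s L2 snd" by (simp_all add: rlie_hom_on_def)
  then show "torus L1 (fst ` s)" "torus L2 (snd ` s)"
    using torus_image[OF Lax(1,2) _ p s] torus_image[OF Lax(1,3) _ p s] by blast+
qed

lemma subspace_torus: "torus L1 s \<Longrightarrow> L1.subspace s" "torus L2 s' \<Longrightarrow> L2.subspace s'"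
  "torus L u \<Longrightarrow> L.subspace u"
  by (simp_all add: torus_def p_subalgebra_def)

text \<open>
  Both the bracket and the \<open>p\<close>-map are computed componentwise, so the criterion of an injective
  \<open>p\<close>-map is inherited from \<open>t1\<close> and \<open>t2\<close>.
\<close>

lemma torus_t: "torus L t"
proof (rule torus_if_pmap_injective[OF char_pos L.restricted_lie_algebra_axioms fd])
  show "p_subalgebra L t"
    using p_subalgebra_t1 p_subalgebra_t2 subspace_Times by (auto simp: p_subalgebra_def)
  show "brk L x y = 0" if "x \<in> t" "y \<in> t" for x y
    using that torus_t1 torus_t2 by (auto simp: torus_def zero_prod_def)
  show "x = 0" if "x \<in> t" "pmap L x = 0" for x
    using that L1.torus_pmap_eq_0[OF char_pos torus_t1] L2.torus_pmap_eq_0[OF char_pos torus_t2]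
    by (auto simp: zero_prod_def)
qed

lemma p_subalgebra_t: "p_subalgebra L t"
  using torus_t by (simp add: torus_def)

lemma torus_le_projections:
  assumes s: "torus L s"
  shows "L.dim s \<le> L1.dim (fst ` s) + L2.dim (snd ` s)"
proof -
  obtain B where "finite_dimensional_vector_space (smult L) B" using basis_of_sum by blast
  then interpret finite_dimensional_vector_space "smult L" B .
  have "s \<subseteq> fst ` s \<times> snd ` s" by force
  then have "L.dim s \<le> L.dim (fst ` s \<times> snd ` s)" by (rule dim_subset)
  then show ?thesis
    using dim_Times[OF subspace_torus(1)[OF torus_fst[OF s]] subspace_torus(2)[OF torus_snd[OF s]]] by simp
qed

lemma dim_t: "L.dim t = L1.dim t1 + L2.dim t2"
  using dim_Times[OF subspace_t1 subspace_t2] .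

lemma maximal_dim_torus_t: "maximal_dim_torus L t"
proof -
  have le: "L.dim s \<le> L.dim t" if "torus L s" for s
    using torus_le_projections[OF that] dim_le_rank(1)[OF torus_fst[OF that]]
      dim_le_rank(2)[OF torus_snd[OF that]] by (simp add: dim_t)
  then have "torus_rank L = L.dim t"
    unfolding torus_rank_def using torus_t
    by (intro Max_eqI) (auto intro: finite_subset[of _ "{..L.dim t}"])
  then show ?thesis using torus_t by (simp add: maximal_dim_torus_def)
qed

text \<open>
  The product of the projections contains \<open>s\<close>, and cannot have a larger dimension, since the
  projections are tori.
\<close>

lemma torus_eq_Times:
  assumes s: "torus L s" and dim: "L.dim s = L.dim t"
  shows "s = fst ` s \<times> snd ` s" "L1.dim (fst ` s) = L1.dim t1" "L2.dim (snd ` s) = L2.dim t2"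
proof -
  obtain B where "finite_dimensional_vector_space (smult L) B" using basis_of_sum by blast
  then interpret finite_dimensional_vector_space "smult L" B .
  note sub = subspace_torus(1)[OF torus_fst[OF s]] subspace_torus(2)[OF torus_snd[OF s]]
  note le = dim_le_rank(1)[OF torus_fst[OF s]] dim_le_rank(2)[OF torus_snd[OF s]]
  show eq: "L1.dim (fst ` s) = L1.dim t1" "L2.dim (snd ` s) = L2.dim t2"
    using torus_le_projections[OF s] le dim dim_t by simp_all
  show "s = fst ` s \<times> snd ` s"
  proof (rule subspace_dim_equal)
    show "L.subspace s" using s by (rule subspace_torus)
    show "L.subspace (fst ` s \<times> snd ` s)" using sub by (rule subspace_Times)
    show "s \<subseteq> fst ` s \<times> snd ` s" by force
    show "L.dim (fst ` s \<times> snd ` s) \<le> L.dim s" using eq dim dim_t dim_Times[OF sub] by simp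
  qed
qed

text \<open>
  The image of \<open>\<phi>\<close> is a product of two tori by \<open>torus_eq_Times\<close>, and \<open>\<phi>\<close> maps the kernel of \<open>fst \<circ> \<phi>\<close>
  bijectively onto the second factor, embedded as \<open>{0} \<times> _\<close>.
\<close>

lemma dim_kernels:
  assumes \<phi>: "\<phi> \<in> torus_embeddings L t"
  shows "L.dim {z \<in> t. fst (\<phi> z) = 0} = L2.dim t2" "L.dim {z \<in> t. snd (\<phi> z) = 0} = L1.dim t1"
proof -
  obtain B where B: "finite_dimensional_vector_space (smult L) B" using basis_of_sum by blast
  have hom: "rlie_hom_on L t L \<phi>" and inj: "inj_on \<phi> t" using \<phi> by (auto simp: torus_embeddings_iff)
  note Lax = L.restricted_lie_algebra_axioms L1.restricted_lie_algebra_axioms L2.restricted_lie_algebra_axioms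
  note dim_im = dim_image[OF Lax(1,1) hom p_subalgebra_t B inj]
  let ?s = "\<phi> ` t"
  have s: "torus L ?s" using torus_image[OF Lax(1,1) hom p_subalgebra_t torus_t] .
  have ds: "L.dim ?s = L.dim t" using dim_im subspace_torus(3)[OF torus_t] by blast
  note prod = torus_eq_Times[OF s ds]
  note sub = subspace_torus(1)[OF torus_fst[OF s]] subspace_torus(2)[OF torus_snd[OF s]]
  have z1: "0 \<in> fst ` ?s" and z2: "0 \<in> snd ` ?s" using sub L1.subspace_0 L2.subspace_0 by auto
  have "L.subspace {z \<in> t. \<phi> z \<in> {x. fst x = 0}}" "L.subspace {z \<in> t. \<phi> z \<in> {x. snd x = 0}}"
    using p_subalgebra_vimage[OF Lax(1,2) rlie_hom_on_comp[OF hom rlie_hom_on_fst] p_subalgebra_t L1.p_subalgebra_zero[OF char_pos]]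
      p_subalgebra_vimage[OF Lax(1,3) rlie_hom_on_comp[OF hom rlie_hom_on_snd] p_subalgebra_t L2.p_subalgebra_zero[OF char_pos]]
    by (simp_all add: p_subalgebra_def)
  then have "L.dim (\<phi> ` {z \<in> t. fst (\<phi> z) = 0}) = L.dim {z \<in> t. fst (\<phi> z) = 0}"
    "L.dim (\<phi> ` {z \<in> t. snd (\<phi> z) = 0}) = L.dim {z \<in> t. snd (\<phi> z) = 0}"
    by (intro dim_im; auto)+
  moreover have "\<phi> ` {z \<in> t. fst (\<phi> z) = 0} = ?s \<inter> {x. fst x = 0}"
    "\<phi> ` {z \<in> t. snd (\<phi> z) = 0} = ?s \<inter> {x. snd x = 0}" by auto
  moreover have "?s \<inter> {x. fst x = 0} = {0} \<times> snd ` ?s" "?s \<inter> {x. snd x = 0} = fst ` ?s \<times> {0}"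
    by (subst prod(1), use z1 in force, subst prod(1), use z2 in force)
  moreover have "L.dim ({0} \<times> snd ` ?s) = L2.dim t2"
    using dim_Times[OF L1.subspace_single_0 sub(2)] L1.dim_span[of "{}"] L1.dim_eq_card_independent[OF L1.independent_empty] prod(3)
    by simp
  moreover have "L.dim (fst ` ?s \<times> {0}) = L1.dim t1"
    using dim_Times[OF sub(1) L2.subspace_single_0] L2.dim_span[of "{}"] L2.dim_eq_card_independent[OF L2.independent_empty] prod(2)
    by simp
  ultimately show "L.dim {z \<in> t. fst (\<phi> z) = 0} = L2.dim t2" "L.dim {z \<in> t. snd (\<phi> z) = 0} = L1.dim t1"
    by simp_all
qed

text \<open>
  The kernels of \<open>fst \<circ> \<phi>\<close> and \<open>snd \<circ> \<phi>\<close> are the same for \<open>\<phi>\<close> as for the inclusion.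
\<close>

lemma component_block_diagonal:
  assumes \<phi>: "\<phi> \<in> embedding_component L t"
  shows "y \<in> t2 \<Longrightarrow> fst (\<phi> (0, y)) = 0" "x \<in> t1 \<Longrightarrow> snd (\<phi> (x, 0)) = 0"
proof -
  note Lax = L.restricted_lie_algebra_axioms L1.restricted_lie_algebra_axioms L2.restricted_lie_algebra_axioms
  have conn: "connected_component_of (subtopology (zariski L t) (torus_embeddings L t)) (\<lambda>z\<in>t. z) \<phi>"
    using \<phi> by (simp add: embedding_component_def)
  have fst_ker: "{z \<in> t. fst ((\<lambda>z\<in>t. z) z) = 0} = {z \<in> t. fst (\<phi> z) = 0}"
    by (rule kernel_constant_on_component[OF Lax(1,2) rlie_hom_on_fst char_pos fd torus_t dim_kernels(1) conn])
  show "fst (\<phi> (0, y)) = 0" if "y \<in> t2"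
  proof -
    have "(0, y) \<in> {z \<in> t. fst ((\<lambda>z\<in>t. z) z) = 0}" using that by simp
    then show ?thesis unfolding fst_ker by simp
  qed
  have snd_ker: "{z \<in> t. snd ((\<lambda>z\<in>t. z) z) = 0} = {z \<in> t. snd (\<phi> z) = 0}"
    by (rule kernel_constant_on_component[OF Lax(1,3) rlie_hom_on_snd char_pos fd torus_t dim_kernels(2) conn])
  show "snd (\<phi> (x, 0)) = 0" if "x \<in> t1"
  proof -
    have "(x, 0) \<in> {z \<in> t. snd ((\<lambda>z\<in>t. z) z) = 0}" using that by simp
    then show ?thesis unfolding snd_ker by simp
  qed
qed

lemma component_eq_pair_map:
  assumes \<phi>: "\<phi> \<in> embedding_component L t"
  shows "\<phi> = pair_map t1 t2 (fst_block t1 \<phi>) (snd_block t2 \<phi>)"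
proof (rule extensionalityI)
  have T: "\<phi> \<in> torus_embeddings L t" using \<phi> embedding_component_subset by blast
  then show "\<phi> \<in> extensional t" by (simp add: torus_embeddings_iff)
  show "pair_map t1 t2 (fst_block t1 \<phi>) (snd_block t2 \<phi>) \<in> extensional t" by (rule pair_map_extensional)
  fix z assume "z \<in> t"
  then obtain x y where z: "z = (x, y)" "x \<in> t1" "y \<in> t2" by blast
  have "\<phi> ((x, 0) + (0, y)) = \<phi> (x, 0) + \<phi> (0, y)"
    using T z by (intro rlie_hom_onD(1)[of L t L]) (auto simp: torus_embeddings_iff)
  then have "\<phi> (x, y) = (fst (\<phi> (x, 0)), snd (\<phi> (0, y)))"
    using z component_block_diagonal[OF \<phi>] by (simp add: prod_eq_iff)
  then show "\<phi> z = pair_map t1 t2 (fst_block t1 \<phi>) (snd_block t2 \<phi>) z"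
    using z by (simp add: fst_block_def snd_block_def)
qed

lemma pair_map_embedding:
  assumes "a \<in> torus_embeddings L1 t1" "b \<in> torus_embeddings L2 t2"
  shows "pair_map t1 t2 a b \<in> torus_embeddings L t"
  using assms
  by (auto simp: torus_embeddings_iff pair_map_extensional rlie_hom_on_def inj_on_def
      L1.p_subalgebra_closed[OF p_subalgebra_t1] L2.p_subalgebra_closed[OF p_subalgebra_t2])

lemma blocks_embedding:
  assumes "\<phi> \<in> embedding_component L t"
  shows "fst_block t1 \<phi> \<in> torus_embeddings L1 t1" "snd_block t2 \<phi> \<in> torus_embeddings L2 t2"
proof -
  have T: "\<phi> \<in> torus_embeddings L t" using assms embedding_component_subset by blast
  then have hom: "rlie_hom_on L t L \<phi>" and inj: "inj_on \<phi> t"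
    by (simp_all add: torus_embeddings_iff)
  have "rlie_hom_on L1 t1 L (\<lambda>x. (x, 0))" "rlie_hom_on L2 t2 L (\<lambda>y. (0, y))"
    using L1.pmap_0 L2.pmap_0 char_pos
    by (simp_all add: rlie_hom_on_def L1.brk_0_left L2.brk_0_left)
  then have "rlie_hom_on L1 t1 L (\<lambda>x. \<phi> (x, 0))" "rlie_hom_on L2 t2 L (\<lambda>y. \<phi> (0, y))"
    using hom by (auto intro: rlie_hom_on_trans)
  then have "rlie_hom_on L1 t1 L1 (\<lambda>x. fst (\<phi> (x, 0)))" "rlie_hom_on L2 t2 L2 (\<lambda>y. snd (\<phi> (0, y)))"
    using rlie_hom_on_comp rlie_hom_on_fst rlie_hom_on_snd by blast+
  then have "rlie_hom_on L1 t1 L1 (fst_block t1 \<phi>)" "rlie_hom_on L2 t2 L2 (snd_block t2 \<phi>)"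
    unfolding fst_block_def snd_block_def
    using L1.rlie_hom_on_restrict[OF p_subalgebra_t1] L2.rlie_hom_on_restrict[OF p_subalgebra_t2] by blast+
  moreover have "inj_on (fst_block t1 \<phi>) t1"
  proof (rule inj_onI)
    fix x x' assume x: "x \<in> t1" "x' \<in> t1" "fst_block t1 \<phi> x = fst_block t1 \<phi> x'"
    then have "\<phi> (x, 0) = \<phi> (x', 0)"
      using component_block_diagonal(2)[OF assms] by (simp add: fst_block_def prod_eq_iff)
    then show "x = x'" using inj_onD[OF inj, of "(x, 0)" "(x', 0)"] x by simp
  qed
  moreover have "inj_on (snd_block t2 \<phi>) t2"
  proof (rule inj_onI)
    fix y y' assume y: "y \<in> t2" "y' \<in> t2" "snd_block t2 \<phi> y = snd_block t2 \<phi> y'"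
    then have "\<phi> (0, y) = \<phi> (0, y')"
      using component_block_diagonal(1)[OF assms] by (simp add: snd_block_def prod_eq_iff)
    then show "y = y'" using inj_onD[OF inj, of "(0, y)" "(0, y')"] y by simp
  qed
  ultimately show "fst_block t1 \<phi> \<in> torus_embeddings L1 t1" "snd_block t2 \<phi> \<in> torus_embeddings L2 t2"
    by (simp_all add: torus_embeddings_iff fst_block_def snd_block_def)
qed

lemma pair_map_lin_maps:
  "a \<in> lin_maps L1 t1 \<Longrightarrow> b \<in> lin_maps L2 t2 \<Longrightarrow> pair_map t1 t2 a b \<in> lin_maps L t"
  by (auto simp: lin_maps_def pair_map_extensional
      L1.p_subalgebra_closed[OF p_subalgebra_t1] L2.p_subalgebra_closed[OF p_subalgebra_t2])

lemma functional_split: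
  assumes "Vector_Spaces.linear (smult L) (*) l"
  shows "Vector_Spaces.linear (smult L1) (*) (\<lambda>x. l (x, 0))" "Vector_Spaces.linear (smult L2) (*) (\<lambda>y. l (0, y))"
    "l (x, y) = l (x, 0) + l (0, y)"
proof -
  interpret K: vector_space "(*) :: 'k \<Rightarrow> 'k \<Rightarrow> 'k" by (rule vector_space_mult)
  interpret l: Vector_Spaces.linear "smult L" "(*)" l by fact
  show "Vector_Spaces.linear (smult L1) (*) (\<lambda>x. l (x, 0))"
    using l.add[of "(_, 0)" "(_, 0)"] l.scale[of _ "(_, 0)"] by unfold_locales simp_all
  show "Vector_Spaces.linear (smult L2) (*) (\<lambda>y. l (0, y))"
    using l.add[of "(0, _)" "(0, _)"] l.scale[of _ "(0, _)"] by unfold_locales simp_all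
  show "l (x, y) = l (x, 0) + l (0, y)" using l.add[of "(x, 0)" "(0, y)"] by simp
qed

abbreviation "embeddings_top M s \<equiv> subtopology (zariski M s) (torus_embeddings M s)"

lemma continuous_pair_map_left:
  assumes b: "b \<in> torus_embeddings L2 t2"
  shows "continuous_map (embeddings_top L1 t1) (embeddings_top L t) (\<lambda>a. pair_map t1 t2 a b)"
proof -
  have "continuous_map (zariski L1 t1) (zariski L t) (\<lambda>a. pair_map t1 t2 a b)"
  proof (rule continuous_map_zariski)
    show "(\<lambda>a. pair_map t1 t2 a b) \<in> lin_maps L1 t1 \<rightarrow> lin_maps L t"
      using pair_map_lin_maps b torus_embeddings_subset_lin_maps by blast
    fix l z assume l: "Vector_Spaces.linear (smult L) (*) l" and "z \<in> t"
    then obtain x y where z: "z = (x, y)" "x \<in> t1" "y \<in> t2" by blast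
    have "(\<lambda>a. l (pair_map t1 t2 a b z)) = (\<lambda>a. l (a x, 0) + l (0, b y))"
      unfolding z(1) pair_map_apply[OF z(2,3)] by (intro ext) (rule functional_split(3)[OF l])
    then show "(\<lambda>a. l (pair_map t1 t2 a b z)) \<in> poly_funs L1 t1"
      using poly_funs.add[OF poly_funs.coeff[OF functional_split(1)[OF l] z(2)] poly_funs.const] by simp
  qed
  then show ?thesis using pair_map_embedding b
    by (auto simp: continuous_map_in_subtopology topspace_embeddings intro: continuous_map_from_subtopology)
qed

lemma continuous_pair_map_right:
  assumes a: "a \<in> torus_embeddings L1 t1"
  shows "continuous_map (embeddings_top L2 t2) (embeddings_top L t) (\<lambda>b. pair_map t1 t2 a b)"
proof -
  have "continuous_map (zariski L2 t2) (zariski L t) (\<lambda>b. pair_map t1 t2 a b)"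
  proof (rule continuous_map_zariski)
    show "(\<lambda>b. pair_map t1 t2 a b) \<in> lin_maps L2 t2 \<rightarrow> lin_maps L t"
      using pair_map_lin_maps a torus_embeddings_subset_lin_maps by blast
    fix l z assume l: "Vector_Spaces.linear (smult L) (*) l" and "z \<in> t"
    then obtain x y where z: "z = (x, y)" "x \<in> t1" "y \<in> t2" by blast
    have "(\<lambda>b. l (pair_map t1 t2 a b z)) = (\<lambda>b. l (a x, 0) + l (0, b y))"
      unfolding z(1) pair_map_apply[OF z(2,3)] by (intro ext) (rule functional_split(3)[OF l])
    then show "(\<lambda>b. l (pair_map t1 t2 a b z)) \<in> poly_funs L2 t2"
      using poly_funs.add[OF poly_funs.const poly_funs.coeff[OF functional_split(2)[OF l] z(3)]] by simp
  qed
  then show ?thesis using pair_map_embedding a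
    by (auto simp: continuous_map_in_subtopology topspace_embeddings intro: continuous_map_from_subtopology)
qed

lemma continuous_blocks:
  "continuous_map (zariski L t) (zariski L1 t1) (fst_block t1)"
  "continuous_map (zariski L t) (zariski L2 t2) (snd_block t2)"
proof -
  have lin: "\<phi> (x + x', 0) = \<phi> (x, 0) + \<phi> (x', 0)" "\<phi> (smult L1 c x, 0) = smult L c (\<phi> (x, 0))"
    if "\<phi> \<in> lin_maps L t" "x \<in> t1" "x' \<in> t1" for \<phi> x x' c
  proof -
    have "\<phi> ((x, 0) + (x', 0)) = \<phi> (x, 0) + \<phi> (x', 0)" "\<phi> (smult L c (x, 0)) = smult L c (\<phi> (x, 0))"
      using that unfolding lin_maps_def by (blast intro: SigmaI zero_in)+
    then show "\<phi> (x + x', 0) = \<phi> (x, 0) + \<phi> (x', 0)" "\<phi> (smult L1 c x, 0) = smult L c (\<phi> (x, 0))" by simp_all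
  qed
  have lin': "\<phi> (0, y + y') = \<phi> (0, y) + \<phi> (0, y')" "\<phi> (0, smult L2 c y) = smult L c (\<phi> (0, y))"
    if "\<phi> \<in> lin_maps L t" "y \<in> t2" "y' \<in> t2" for \<phi> y y' c
  proof -
    have "\<phi> ((0, y) + (0, y')) = \<phi> (0, y) + \<phi> (0, y')" "\<phi> (smult L c (0, y)) = smult L c (\<phi> (0, y))"
      using that unfolding lin_maps_def by (blast intro: SigmaI zero_in)+
    then show "\<phi> (0, y + y') = \<phi> (0, y) + \<phi> (0, y')" "\<phi> (0, smult L2 c y) = smult L c (\<phi> (0, y))" by simp_all
  qed
  have fst: "Vector_Spaces.linear (smult L) (smult L1) fst" and snd: "Vector_Spaces.linear (smult L) (smult L2) snd"
    by unfold_locales auto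
  show "continuous_map (zariski L t) (zariski L1 t1) (fst_block t1)"
  proof (rule continuous_map_zariski)
    show "fst_block t1 \<in> lin_maps L t \<rightarrow> lin_maps L1 t1"
      by (auto simp: lin_maps_def[of L1] fst_block_def lin L1.p_subalgebra_closed[OF p_subalgebra_t1])
    show "(\<lambda>\<phi>. l (fst_block t1 \<phi> x)) \<in> poly_funs L t"
      if "Vector_Spaces.linear (smult L1) (*) l" "x \<in> t1" for l x
      using that(2) poly_funs.coeff[OF Vector_Spaces.linear_compose[OF fst that(1)], of "(x, 0)" t]
      by (simp add: fst_block_def)
  qed
  show "continuous_map (zariski L t) (zariski L2 t2) (snd_block t2)"
  proof (rule continuous_map_zariski)
    show "snd_block t2 \<in> lin_maps L t \<rightarrow> lin_maps L2 t2"
      by (auto simp: lin_maps_def[of L2] snd_block_def lin' L2.p_subalgebra_closed[OF p_subalgebra_t2])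
    show "(\<lambda>\<phi>. l (snd_block t2 \<phi> y)) \<in> poly_funs L t"
      if "Vector_Spaces.linear (smult L2) (*) l" "y \<in> t2" for l y
      using that(2) poly_funs.coeff[OF Vector_Spaces.linear_compose[OF snd that(1)], of "(0, y)" t]
      by (simp add: snd_block_def)
  qed
qed

text \<open>
  Taking blocks is continuous on all linear maps, but it yields embeddings only for block diagonal
  ones. Therefore the whole component is mapped, rather than the space of embeddings.
\<close>

lemma blocks_component:
  assumes \<phi>: "\<phi> \<in> embedding_component L t"
  shows "fst_block t1 \<phi> \<in> embedding_component L1 t1" "snd_block t2 \<phi> \<in> embedding_component L2 t2"
proof -
  let ?X = "embedding_component L t" and ?i = "\<lambda>z\<in>t. z"
  have "connectedin (embeddings_top L t) ?X"
    unfolding embedding_component_def by (rule connectedin_connected_component_of)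
  then have conn: "connectedin (zariski L t) ?X" unfolding connectedin_subtopology by (rule conjunct1)
  have i: "?i \<in> ?X"
    using L.inclusion_embedding[OF p_subalgebra_t]
    unfolding embedding_component_def mem_Collect_eq connected_component_of_refl topspace_embeddings .
  have "connectedin (embeddings_top L1 t1) (fst_block t1 ` ?X)"
    unfolding connectedin_subtopology
    using connectedin_continuous_map_image[OF continuous_blocks(1) conn] blocks_embedding(1) by blast
  moreover have "fst_block t1 ?i = (\<lambda>x\<in>t1. x)"
    unfolding fst_block_def by (rule restrict_ext) simp
  ultimately show "fst_block t1 \<phi> \<in> embedding_component L1 t1"
    unfolding embedding_component_def[of L1] mem_Collect_eq connected_component_of_def
    using imageI[OF i, of "fst_block t1"] imageI[OF \<phi>, of "fst_block t1"]
    by (intro exI[of _ "fst_block t1 ` ?X"] conjI) simp_all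
  have "connectedin (embeddings_top L2 t2) (snd_block t2 ` ?X)"
    unfolding connectedin_subtopology
    using connectedin_continuous_map_image[OF continuous_blocks(2) conn] blocks_embedding(2) by blast
  moreover have "snd_block t2 ?i = (\<lambda>y\<in>t2. y)"
    unfolding snd_block_def by (rule restrict_ext) simp
  ultimately show "snd_block t2 \<phi> \<in> embedding_component L2 t2"
    unfolding embedding_component_def[of L2] mem_Collect_eq connected_component_of_def
    using imageI[OF i, of "snd_block t2"] imageI[OF \<phi>, of "snd_block t2"]
    by (intro exI[of _ "snd_block t2 ` ?X"] conjI) simp_all
qed

text \<open>
  The inclusion is joined to \<open>(a, id)\<close> in one slice, and \<open>(a, id)\<close> to \<open>(a, b)\<close> in another.
\<close>

lemma pair_map_component:
  assumes a: "a \<in> embedding_component L1 t1" and b: "b \<in> embedding_component L2 t2"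
  shows "pair_map t1 t2 a b \<in> embedding_component L t"
proof -
  have i: "(\<lambda>z\<in>t. z) = pair_map t1 t2 (\<lambda>x\<in>t1. x) (\<lambda>y\<in>t2. y)"
    by (auto simp: pair_map_def)
  have aT: "a \<in> torus_embeddings L1 t1" using a embedding_component_subset by blast
  have "connected_component_of (embeddings_top L t) (pair_map t1 t2 (\<lambda>x\<in>t1. x) (\<lambda>y\<in>t2. y)) (pair_map t1 t2 a (\<lambda>y\<in>t2. y))"
    using a unfolding embedding_component_def mem_Collect_eq
    by (rule connected_component_of_continuous_image[OF continuous_pair_map_left[OF L2.inclusion_embedding[OF p_subalgebra_t2]]])
  moreover have "connected_component_of (embeddings_top L t) (pair_map t1 t2 a (\<lambda>y\<in>t2. y)) (pair_map t1 t2 a b)"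
    using b unfolding embedding_component_def mem_Collect_eq
    by (rule connected_component_of_continuous_image[OF continuous_pair_map_right[OF aT]])
  ultimately show ?thesis
    unfolding embedding_component_def mem_Collect_eq i by (rule connected_component_of_trans)
qed

lemma fst_block_pair_map: "a \<in> extensional t1 \<Longrightarrow> fst_block t1 (pair_map t1 t2 a b) = a"
  and snd_block_pair_map: "b \<in> extensional t2 \<Longrightarrow> snd_block t2 (pair_map t1 t2 a b) = b"
  by (auto simp: fst_block_def snd_block_def fun_eq_iff extensional_def)

lemma in_S_group_iff:
  "h \<in> carrier (S_group L1 t1) \<longleftrightarrow> h \<in> embedding_component L1 t1 \<and> h ` t1 = t1"
  "k \<in> carrier (S_group L2 t2) \<longleftrightarrow> k \<in> embedding_component L2 t2 \<and> k ` t2 = t2"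
  "g \<in> carrier (S_group L t) \<longleftrightarrow> g \<in> embedding_component L t \<and> g ` t = t"
  using embedding_component_subset[of L1 t1] embedding_component_subset[of L2 t2] embedding_component_subset[of L t]
  by (auto simp: L1.carrier_S_group[OF p_subalgebra_t1] L2.carrier_S_group[OF p_subalgebra_t2]
      L.carrier_S_group[OF p_subalgebra_t] carrier_Aut_p torus_embeddings_def Bij_def bij_betw_def
      restricted_homs_iff)

lemma pair_map_image: "pair_map t1 t2 a b ` t = (a ` t1) \<times> (b ` t2)"
  by (force simp: pair_map_def)

lemma Times_eq_t: "A \<times> B = t \<longleftrightarrow> A = t1 \<and> B = t2"
proof -
  have "t1 \<noteq> {}" "t2 \<noteq> {}" using zero_in by blast+
  then show ?thesis by (auto simp: times_eq_iff)
qed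

lemma S_group_iso: "S_group L t \<cong> S_group L1 t1 \<times>\<times> S_group L2 t2"
proof (rule is_isoI)
  let ?f = "\<lambda>\<phi>. (fst_block t1 \<phi>, snd_block t2 \<phi>)"
  have blocks: "fst_block t1 \<phi> \<in> carrier (S_group L1 t1)" "snd_block t2 \<phi> \<in> carrier (S_group L2 t2)"
    "pair_map t1 t2 (fst_block t1 \<phi>) (snd_block t2 \<phi>) = \<phi>"
    if "\<phi> \<in> carrier (S_group L t)" for \<phi>
  proof -
    have X: "\<phi> \<in> embedding_component L t" and im: "\<phi> ` t = t" using that in_S_group_iff(3) by blast+
    show eq: "pair_map t1 t2 (fst_block t1 \<phi>) (snd_block t2 \<phi>) = \<phi>"
      using component_eq_pair_map[OF X] by simp
    have "fst_block t1 \<phi> ` t1 = t1 \<and> snd_block t2 \<phi> ` t2 = t2"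
      using im pair_map_image[of "fst_block t1 \<phi>" "snd_block t2 \<phi>"] unfolding eq Times_eq_t[symmetric] by simp
    then show "fst_block t1 \<phi> \<in> carrier (S_group L1 t1)" "snd_block t2 \<phi> \<in> carrier (S_group L2 t2)"
      using blocks_component[OF X] in_S_group_iff(1,2) by blast+
  qed
  have ext: "h \<in> extensional t1" "h \<in> t1 \<rightarrow> t1" if "h \<in> carrier (S_group L1 t1)" for h
    using that embedding_component_subset[of L1 t1] by (auto simp: in_S_group_iff torus_embeddings_iff)
  have ext': "k \<in> extensional t2" "k \<in> t2 \<rightarrow> t2" if "k \<in> carrier (S_group L2 t2)" for k
    using that embedding_component_subset[of L2 t2] by (auto simp: in_S_group_iff torus_embeddings_iff)
  have pair: "pair_map t1 t2 h k \<in> carrier (S_group L t)" "?f (pair_map t1 t2 h k) = (h, k)"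
    if "h \<in> carrier (S_group L1 t1)" "k \<in> carrier (S_group L2 t2)" for h k
    using that ext ext' pair_map_component[of h k]
    by (auto simp: in_S_group_iff pair_map_image fst_block_pair_map snd_block_pair_map)
  show "?f \<in> iso (S_group L t) (S_group L1 t1 \<times>\<times> S_group L2 t2)"
    unfolding iso_def hom_def mem_Collect_eq
  proof (intro conjI ballI)
    show "?f \<in> carrier (S_group L t) \<rightarrow> carrier (S_group L1 t1 \<times>\<times> S_group L2 t2)"
      using blocks by auto
  next
    fix \<phi> \<psi> assume \<phi>: "\<phi> \<in> carrier (S_group L t)" and \<psi>: "\<psi> \<in> carrier (S_group L t)"
    note b = blocks(1,2)[OF \<phi>] blocks(1,2)[OF \<psi>]
    have "\<phi> \<otimes>\<^bsub>S_group L t\<^esub> \<psi> = compose t \<phi> \<psi>"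
      using L.mult_S_group[OF p_subalgebra_t \<phi> \<psi>] .
    also have "\<dots> = pair_map t1 t2 (compose t1 (fst_block t1 \<phi>) (fst_block t1 \<psi>)) (compose t2 (snd_block t2 \<phi>) (snd_block t2 \<psi>))"
      using compose_pair_map[of "fst_block t1 \<psi>" t1 "snd_block t2 \<psi>" t2 "fst_block t1 \<phi>" "snd_block t2 \<phi>"]
        blocks(3)[OF \<phi>] blocks(3)[OF \<psi>] b by (simp add: in_S_group_iff)
    finally show "?f (\<phi> \<otimes>\<^bsub>S_group L t\<^esub> \<psi>) = ?f \<phi> \<otimes>\<^bsub>S_group L1 t1 \<times>\<times> S_group L2 t2\<^esub> ?f \<psi>"
      by (simp add: fst_block_pair_map snd_block_pair_map L1.mult_S_group[OF p_subalgebra_t1 b(1,3)]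
          L2.mult_S_group[OF p_subalgebra_t2 b(2,4)] compose_extensional)
  next
    show "bij_betw ?f (carrier (S_group L t)) (carrier (S_group L1 t1 \<times>\<times> S_group L2 t2))"
      by (rule bij_betw_byWitness[where f' = "\<lambda>(h, k). pair_map t1 t2 h k"]) (use blocks pair in auto)
  qed
qed

end

theorem corollary2p4:
  fixes L1 :: "('k::alg_closed_field, 'a::ab_group_add) rlie"
    and L2 :: "('k, 'b::ab_group_add) rlie"
    and t1 :: "'a set" and t2 :: "'b set"
  assumes "CHAR('k) > 0"
    and "restricted_lie_algebra L1" and "finite_dimensional L1"
    and "restricted_lie_algebra L2" and "finite_dimensional L2"
    and "maximal_dim_torus L1 t1" and "maximal_dim_torus L2 t2"
  shows "maximal_dim_torus (L1 \<oplus>\<^sub>L L2) (t1 \<times> t2) \<and>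
    S_group (L1 \<oplus>\<^sub>L L2) (t1 \<times> t2) \<cong> S_group L1 t1 \<times>\<times> S_group L2 t2"
proof -
  interpret direct_sum_tori L1 L2 t1 t2
    using assms by (intro direct_sum_tori.intro direct_sum_tori_axioms.intro)
  show ?thesis using maximal_dim_torus_t S_group_iso by blast
qed

end
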